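(* For every $k\ge 2$, $\Lambda_k\in\mathbb{Z}[\xi]$. More precisely, writing $\Lambda_k=\sum_m c_k(m)\xi^m$ (a finite sum with integer coefficients), one has $$\Lambda_2=3\xi^2-2\xi^3,$$ and for $k\ge 3$, $$\Lambda_k=\sum_{\ell}c_{k-1}(\ell)\,\zeta_{2^{k-3},\ell},$$ where $\zeta_{i,j}=U(\kappa^i\xi^j)$.
   Context: Let $E(q)=\prod_{m\ge1}(1-q^m)$. $PDO(n)$ is the number of partitions of $n$ into odd parts with designated summands (for each distinct part size, exactly one occurrence is designated); its generating function is $\sum_{n\ge0}PDO(n)q^n=\frac{E(q^4)E(q^6)^2}{E(q)E(q^3)E(q^{12})}$. Define $$\gamma(q)=\frac{E(q)^5E(q^2)^5E(q^6)^5}{E(q^3)^{15}},\quad \xi=\xi(q)=\frac{E(q^2)^5E(q^6)}{E(q)E(q^3)^5},\quad \kappa(q)=\frac{\gamma(q^2)^2}{\gamma(q)},$$ and for $k\ge2$, $\Lambda_k=\Lambda_k(q)=\gamma(q)^{2^{k-2}}\sum_{n\ge0}PDO(2^kn)q^n$. $U$ is the operator $U\left(\sum_n a_nq^n\right)=\sum_n a_{2n}q^n$. Membership in $\mathbb{Z}[\xi]$ means equality, as formal power series in $q$, with a polynomial in $\xi$ with integer coefficients. *)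

theory Defs
  imports "HOL-Computational_Algebra.Formal_Power_Series" "HOL-Computational_Algebra.Polynomial"
begin

text \<open>E(q^k) = prod_{m>=1} (1 - q^(k m)) as a formal power series over the rationals.
  For k >= 1 the coefficient of q^n only depends on the factors with m <= n.\<close>
definition Eta :: "nat \<Rightarrow> rat fps" where
  "Eta k = Abs_fps (\<lambda>n. fps_nth (\<Prod>m\<in>{1..n}. (1 - fps_X ^ (k * m) :: rat fps)) n)"

definition fps_dilate :: "nat \<Rightarrow> rat fps \<Rightarrow> rat fps" where
  "fps_dilate d f = Abs_fps (\<lambda>n. if d dvd n then fps_nth f (n div d) else 0)"

definition fps_U :: "rat fps \<Rightarrow> rat fps" where
  "fps_U f = Abs_fps (\<lambda>n. fps_nth f (2 * n))"

definition PDO_gf :: "rat fps" where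
  "PDO_gf = Eta 4 * Eta 6 ^ 2 / (Eta 1 * Eta 3 * Eta 12)"

definition PDO :: "nat \<Rightarrow> rat" where
  "PDO n = fps_nth PDO_gf n"

definition gamma_fps :: "rat fps" where
  "gamma_fps = Eta 1 ^ 5 * Eta 2 ^ 5 * Eta 6 ^ 5 / Eta 3 ^ 15"

definition xi_fps :: "rat fps" where
  "xi_fps = Eta 2 ^ 5 * Eta 6 / (Eta 1 * Eta 3 ^ 5)"

definition kappa_fps :: "rat fps" where
  "kappa_fps = (fps_dilate 2 gamma_fps) ^ 2 / gamma_fps"

definition Lambda :: "nat \<Rightarrow> rat fps" where
  "Lambda k = gamma_fps ^ (2 ^ (k - 2)) * Abs_fps (\<lambda>n. PDO (2 ^ k * n))"

definition zeta :: "nat \<Rightarrow> nat \<Rightarrow> rat fps" where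
  "zeta i j = fps_U (kappa_fps ^ i * xi_fps ^ j)"

definition int_poly_at :: "int poly \<Rightarrow> rat fps \<Rightarrow> rat fps" where
  "int_poly_at p f = poly (map_poly (\<lambda>a. fps_const (of_int a)) p) f"

end

theory Submission
  imports Defs "HOL-Computational_Algebra.Formal_Laurent_Series"
begin

text \<open>
  Write $t$ for the eta quotient $E(q^4)^4 E(q^6)^2 / (q\,E(q^2)^2 E(q^{12})^4)$, a Hauptmodul of
  $\Gamma_0(12)$. Dissecting classical theta functions modulo 3 shows that $t \pm 1$ and $t \pm 3$
  are eta quotients as well. With $Y = \xi(q^2)$ and $K = t/(t-1)$ this gives $\kappa = K^5$,
  $K^2 = 2YK - Y$ and $\xi = (2Y - K)(3 - 4Y + 2K)$, so every $\kappa^i \xi^j$ lies in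
  $\mathbb{Z}[Y] + \mathbb{Z}[Y] K$. The operator $U$ maps $A(Y) + B(Y) K$ to $A(\xi) + B(\xi)\,\xi$,
  because $K - Y$ is odd in $q$. Since $\Lambda_k = U(\kappa^{2^{k-3}} \Lambda_{k-1})$, only
  $\Lambda_2$ remains. There the generating function $P$ satisfies $U(P) = P^2$, and
  $\gamma(q^2) P^2 = 3Y^2 - 2Y^3 + 2Y^2 (K - Y)$.
\<close>

section \<open>Congruence of power series and Euler products\<close>

text \<open>The use of $t$ comes from level 6. For $s = E(q^2)^8 E(q^3)^4 / (q E(q)^4 E(q^6)^8)$ one
  has \<xi> $= s/(s-1)$ and $t^2 = s(q^2)$. So $t$ is odd in $q$, $Y = t^2/(t^2-1)$ is even, and $q
  \<mapsto> -q$ sends $K = t/(t-1)$ to its conjugate $t/(t+1)$. The two conjugates have sum $2Y$ and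
  product $Y$: this is the quadratic equation for $K$, and $K - Y = t/(t^2-1)$ is odd. The formula
  for \<xi> is \<xi> $= (t/(t+1)) ((t+3)/(t+1))$, where each factor is linear in $Y$ and $K$. The
  obstacle is to obtain the eta quotients for $t \<plusminus> 1$ and $t \<plusminus> 3$ from formal
  series alone. Those for $t \<plusminus> 1$ and $t - 3$ are roots of quadratic equations supplied
  by the dissections, with the root selected by constant terms; the one for $t + 3$ then follows.
  After that, each remaining level 12 relation is an identity of rational functions of $t$.\<close>

text \<open>Congruence modulo $q^N$. Infinite products and theta series are not treated as limits:
  an identity is proved modulo every $q^N$ with finite products.\<close>

definition eq_upto :: "nat \<Rightarrow> 'a::zero fps \<Rightarrow> 'a fps \<Rightarrow> bool" where
  "eq_upto N f g \<longleftrightarrow> (\<forall>i<N. fps_nth f i = fps_nth g i)"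

lemma eq_upto_refl [simp]: "eq_upto N f f"
  by (simp add: eq_upto_def)

lemma eq_upto_sym: "eq_upto N f g \<Longrightarrow> eq_upto N g f"
  by (simp add: eq_upto_def)

lemma eq_upto_trans [trans]: "eq_upto N f g \<Longrightarrow> eq_upto N g h \<Longrightarrow> eq_upto N f h"
  by (simp add: eq_upto_def)

lemma eq_upto_mono: "eq_upto N f g \<Longrightarrow> M \<le> N \<Longrightarrow> eq_upto M f g"
  by (simp add: eq_upto_def)

lemma eq_upto_mult:
  fixes f g :: "'a::comm_ring_1 fps"
  assumes "eq_upto N f f'" "eq_upto N g g'"
  shows "eq_upto N (f * g) (f' * g')"
  using assms unfolding eq_upto_def fps_mult_nth by (auto intro!: sum.cong)

lemma eq_upto_power:
  fixes f :: "'a::comm_ring_1 fps"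
  shows "eq_upto N f g \<Longrightarrow> eq_upto N (f ^ n) (g ^ n)"
  by (induction n) (auto intro: eq_upto_mult)

lemma eq_upto_sum:
  fixes f :: "'b \<Rightarrow> 'a::comm_ring_1 fps"
  assumes "\<And>x. x \<in> A \<Longrightarrow> eq_upto N (f x) (g x)"
  shows "eq_upto N (sum f A) (sum g A)"
  using assms by (auto simp: eq_upto_def fps_sum_nth intro!: sum.cong)

text \<open>The gain of \<open>k\<close> in precision rescues the outer theta terms in
  \<open>jacobi_triple\<close>, whose cofactor is known only to low order.\<close>

lemma eq_upto_X_power_mult:
  fixes f :: "'a::comm_ring_1 fps"
  assumes "eq_upto N f g"
  shows "eq_upto (N + k) (fps_X ^ k * f) (fps_X ^ k * g)"
  using assms by (auto simp: eq_upto_def fps_X_power_mult_nth)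

lemma eq_upto_cancel:
  fixes f :: "'a::field fps"
  assumes "eq_upto N (h * f) (h * g)" "fps_nth h 0 \<noteq> 0"
  shows "eq_upto N f g"
proof -
  have "inverse h * h = 1"
    using assms(2) by (rule inverse_mult_eq_1)
  moreover have "eq_upto N (inverse h * (h * f)) (inverse h * (h * g))"
    using assms(1) by (rule eq_upto_mult[OF eq_upto_refl])
  moreover have "inverse h * (h * f) = (inverse h * h) * f" "inverse h * (h * g) = (inverse h * h) * g"
    by (simp_all only: mult.assoc)
  ultimately show ?thesis
    by (simp only: mult_1)
qed

lemma fps_eq_upto_eqI: "(\<And>N. N > 0 \<Longrightarrow> eq_upto N f g) \<Longrightarrow> f = g"
  by (rule fps_ext) (auto simp: eq_upto_def)

section \<open>Truncated Euler products\<close>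

definition eta_fin :: "nat \<Rightarrow> nat \<Rightarrow> rat fps" where
  "eta_fin k N = (\<Prod>m<N. 1 - fps_X ^ (k * Suc m))"

lemma eta_fin_0 [simp]: "eta_fin k 0 = 1"
  by (simp add: eta_fin_def)

lemma eta_fin_Suc: "eta_fin k (Suc N) = eta_fin k N * (1 - fps_X ^ (k * Suc N))"
  by (simp add: eta_fin_def)

lemma Eta_nth_eta_fin: "fps_nth (Eta k) n = fps_nth (eta_fin k n) n"
proof -
  have "(\<Prod>m\<in>{1..n}. (1 - fps_X ^ (k * m) :: rat fps)) = eta_fin k n"
    by (induction n) (auto simp: eta_fin_Suc)
  thus ?thesis by (simp add: Eta_def)
qed

text \<open>The first omitted factor is $1 - q^{k(N+1)}$. The sharp order matters: for
  \<open>a + b = 1\<close>, a term at distance 1 from the centre leaves no slack in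
  \<open>jacobi_triple\<close>.\<close>

lemma eta_fin_stable:
  assumes "k \<ge> 1" "N \<le> M"
  shows "eq_upto (k * Suc N) (eta_fin k M) (eta_fin k N)"
  using \<open>N \<le> M\<close>
proof (induction M rule: dec_induct)
  case (step M)
  have "eq_upto (k * Suc M) (1 - fps_X ^ (k * Suc M) :: rat fps) 1"
    by (auto simp: eq_upto_def)
  hence "eq_upto (k * Suc N) (1 - fps_X ^ (k * Suc M) :: rat fps) 1"
    by (rule eq_upto_mono) (use step in auto)
  from eq_upto_mult[OF step.IH this] show ?case
    by (simp add: eta_fin_Suc)
qed auto

lemma eq_upto_Eta_Suc:
  assumes "k \<ge> 1"
  shows "eq_upto (k * Suc N) (Eta k) (eta_fin k N)"
  unfolding eq_upto_def
proof (intro allI impI)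
  fix i assume i: "i < k * Suc N"
  show "fps_nth (Eta k) i = fps_nth (eta_fin k N) i"
  proof (cases "i \<le> N")
    case True
    have "i < k * Suc i" using assms by (cases k) auto
    thus ?thesis
      using eta_fin_stable[OF assms True] by (simp add: Eta_nth_eta_fin eq_upto_def)
  next
    case False
    thus ?thesis
      using eta_fin_stable[OF assms, of N i] i by (simp add: Eta_nth_eta_fin eq_upto_def)
  qed
qed

lemma eq_upto_Eta:
  assumes "k \<ge> 1" "M \<le> N"
  shows "eq_upto M (Eta k) (eta_fin k N)"
proof (rule eq_upto_mono[OF eq_upto_Eta_Suc[OF assms(1)]])
  have "M \<le> 1 * Suc N" using assms by simp
  also have "\<dots> \<le> k * Suc N" by (intro mult_le_mono) (use assms in auto)
  finally show "M \<le> k * Suc N" .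
qed

lemma Eta_nth_0 [simp]: "fps_nth (Eta k) 0 = 1"
  by (simp add: Eta_def)

lemma Eta_nonzero [simp]: "Eta k \<noteq> 0"
  by (metis Eta_nth_0 fps_zero_nth zero_neq_one)

section \<open>The substitution of $q^d$ for $q$\<close>

lemma fps_dilate_conv_compose: "d > 0 \<Longrightarrow> fps_dilate d f = fps_compose f (fps_X ^ d)"
  by (rule fps_ext) (simp add: fps_dilate_def fps_nth_compose_X_power)

lemma fps_dilate_nth: "fps_nth (fps_dilate d f) n = (if d dvd n then fps_nth f (n div d) else 0)"
  by (simp add: fps_dilate_def)

lemma fps_dilate_add: "fps_dilate d (f + g) = fps_dilate d f + fps_dilate d g"
  by (rule fps_ext) (simp add: fps_dilate_nth)

lemma fps_dilate_diff: "fps_dilate d (f - g) = fps_dilate d f - fps_dilate d g"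
  by (rule fps_ext) (simp add: fps_dilate_nth)

lemma fps_dilate_const: "d > 0 \<Longrightarrow> fps_dilate d (fps_const c) = fps_const c"
  by (rule fps_ext) (auto simp: fps_dilate_nth)

lemma fps_dilate_1: "d > 0 \<Longrightarrow> fps_dilate d 1 = 1"
  using fps_dilate_const[of d 1] by simp

lemma fps_dilate_numeral: "d > 0 \<Longrightarrow> fps_dilate d (numeral n) = numeral n"
  using fps_dilate_const[of d "numeral n"] by (simp add: numeral_fps_const)

lemma fps_dilate_mult: "d > 0 \<Longrightarrow> fps_dilate d (f * g) = fps_dilate d f * fps_dilate d g"
  by (simp add: fps_dilate_conv_compose fps_compose_mult_distrib)

lemma fps_dilate_power: "d > 0 \<Longrightarrow> fps_dilate d (f ^ n) = fps_dilate d f ^ n"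
  by (simp add: fps_dilate_conv_compose fps_compose_power)

lemma fps_dilate_X: "d > 0 \<Longrightarrow> fps_dilate d fps_X = fps_X ^ d"
  by (simp add: fps_dilate_conv_compose)

lemma fps_dilate_X_power: "d > 0 \<Longrightarrow> fps_dilate d (fps_X ^ n) = fps_X ^ (d * n)"
  by (simp only: fps_dilate_power fps_dilate_X power_mult)

lemma fps_dilate_nth_0 [simp]: "fps_nth (fps_dilate d f) 0 = fps_nth f 0"
  by (simp add: fps_dilate_nth)

lemma fps_dilate_inverse:
  assumes "d > 0" "fps_nth f 0 \<noteq> 0"
  shows "fps_dilate d (inverse f) = inverse (fps_dilate d f)"
proof -
  have "fps_dilate d f * fps_dilate d (inverse f) = fps_dilate d (f * inverse f)"
    using assms(1) by (simp only: fps_dilate_mult)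
  also have "f * inverse f = 1"
    using inverse_mult_eq_1[OF assms(2)] by (subst mult.commute)
  finally have "fps_dilate d f * fps_dilate d (inverse f) = 1"
    using assms(1) by (simp only: fps_dilate_1)
  from fps_inverse_unique[OF this] show ?thesis ..
qed

lemma fps_dilate_divide:
  assumes "d > 0" "fps_nth g 0 \<noteq> 0"
  shows "fps_dilate d (f / g) = fps_dilate d f / fps_dilate d g"
  using assms by (simp add: fps_divide_unit fps_dilate_mult fps_dilate_inverse)

lemma fps_dilate_dilate:
  assumes "d > 0" "e > 0"
  shows "fps_dilate d (fps_dilate e f) = fps_dilate (d * e) f"
proof (rule fps_ext)
  fix n
  have "d dvd n \<and> e dvd n div d \<longleftrightarrow> d * e dvd n"
    using assms dvd_div_iff_mult[of d n e] by (metis dvd_mult_left mult.commute less_numeral_extra(3))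
  thus "fps_nth (fps_dilate d (fps_dilate e f)) n = fps_nth (fps_dilate (d * e) f) n"
    by (auto simp only: fps_dilate_nth div_mult2_eq split: if_splits)
qed

lemma fps_dilate_eta_fin:
  assumes "d > 0"
  shows "fps_dilate d (eta_fin k N) = eta_fin (d * k) N"
proof (induction N)
  case 0
  thus ?case using assms by (simp add: fps_dilate_1)
next
  case (Suc N)
  have "fps_dilate d (eta_fin k (Suc N)) =
          fps_dilate d (eta_fin k N) * (1 - fps_X ^ (d * (k * Suc N)))"
    unfolding eta_fin_Suc fps_dilate_mult[OF assms] fps_dilate_diff fps_dilate_1[OF assms]
      fps_dilate_X_power[OF assms] ..
  thus ?case
    by (simp only: Suc eta_fin_Suc mult.assoc)
qed

lemma fps_dilate_Eta:
  assumes "d > 0" "k > 0"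
  shows "fps_dilate d (Eta k) = Eta (d * k)"
proof (rule fps_eq_upto_eqI)
  fix N :: nat
  have "eq_upto N (Eta k) (eta_fin k N)"
    using assms by (intro eq_upto_Eta) auto
  hence "fps_nth (Eta k) (i div d) = fps_nth (eta_fin k N) (i div d)" if "i < N" for i
    using div_le_dividend[of i d] that unfolding eq_upto_def by (meson le_less_trans)
  hence "eq_upto N (fps_dilate d (Eta k)) (fps_dilate d (eta_fin k N))"
    unfolding eq_upto_def fps_dilate_nth by simp
  also have "eq_upto N \<dots> (Eta (d * k))"
    unfolding fps_dilate_eta_fin[OF assms(1)]
    by (rule eq_upto_sym[OF eq_upto_Eta]) (use assms in auto)
  finally show "eq_upto N (fps_dilate d (Eta k)) (Eta (d * k))" .
qed

section \<open>The Jacobi triple product\<close>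

text \<open>Gaussian binomial coefficients, given by the Pascal rule so that no division occurs; the
  quotient formula is \<open>qbin_eta_fin\<close>.\<close>

fun qbin :: "'a::comm_ring_1 \<Rightarrow> nat \<Rightarrow> nat \<Rightarrow> 'a" where
  "qbin q n 0 = 1"
| "qbin q 0 (Suc k) = 0"
| "qbin q (Suc n) (Suc k) = qbin q n (Suc k) + q ^ (n - k) * qbin q n k"

lemma qbin_eq_0: "n < k \<Longrightarrow> qbin q n k = 0"
  by (induction q n k rule: qbin.induct) auto

text \<open>The new factor $x + y q^n$ matches the Pascal rule: passing from
  \<open>k choose 2\<close> to \<open>Suc k choose 2\<close> adds $k$, which turns $q^{n-k}$ into
  $q^n$.\<close>

lemma cauchy_binomial:
  fixes q x y :: "'a::comm_ring_1"
  shows "(\<Prod>i<n. x + y * q ^ i) = (\<Sum>k\<le>n. qbin q n k * q ^ (k choose 2) * x ^ (n - k) * y ^ k)"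
proof (induction n)
  case (Suc n)
  let ?f = "\<lambda>n k. qbin q n k * q ^ (k choose 2) * x ^ (n - k) * y ^ k"
  have split: "?f (Suc n) (Suc k) = x * (if k = n then 0 else ?f n (Suc k)) + y * q ^ n * ?f n k"
    if "k \<le> n" for k
  proof -
    have "q ^ (n - k) * q ^ (Suc k choose 2) = q ^ n * q ^ (k choose 2)"
      using that by (simp add: numeral_2_eq_2 flip: power_add)
    hence "q ^ (n - k) * qbin q n k * q ^ (Suc k choose 2) * x ^ (n - k) * y ^ Suc k = y * q ^ n * ?f n k"
      by (simp add: mult_ac)
    moreover have "qbin q n (Suc k) * q ^ (Suc k choose 2) * x ^ (n - k) * y ^ Suc k =
                     x * (if k = n then 0 else ?f n (Suc k))"
    proof (cases "k = n")
      case False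
      hence "n - k = Suc (n - Suc k)" using that by simp
      thus ?thesis using False by (simp add: mult_ac)
    qed (simp add: qbin_eq_0)
    ultimately show ?thesis
      by (simp add: algebra_simps)
  qed
  have "(\<Sum>k\<le>Suc n. ?f (Suc n) k) = x ^ Suc n + (\<Sum>k\<le>n. ?f (Suc n) (Suc k))"
    by (subst sum.atMost_Suc_shift) (simp add: numeral_2_eq_2)
  also have "(\<Sum>k\<le>n. ?f (Suc n) (Suc k)) =
               x * (\<Sum>k\<le>n. if k = n then 0 else ?f n (Suc k)) + y * q ^ n * (\<Sum>k\<le>n. ?f n k)"
    unfolding sum_distrib_left sum.distrib[symmetric] by (intro sum.cong refl split) auto
  also have "(\<Sum>k\<le>n. if k = n then 0 else ?f n (Suc k)) = (\<Sum>k<n. ?f n (Suc k))"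
    unfolding lessThan_Suc_atMost[symmetric] by simp
  also have "x ^ Suc n + (x * (\<Sum>k<n. ?f n (Suc k)) + y * q ^ n * (\<Sum>k\<le>n. ?f n k)) =
               x * (x ^ n + (\<Sum>k<n. ?f n (Suc k))) + y * q ^ n * (\<Sum>k\<le>n. ?f n k)"
    by (simp add: algebra_simps)
  also have "x ^ n + (\<Sum>k<n. ?f n (Suc k)) = (\<Sum>k\<le>n. ?f n k)"
    unfolding lessThan_Suc_atMost[symmetric] sum.lessThan_Suc_shift by (simp add: numeral_2_eq_2)
  finally have *: "(\<Sum>k\<le>Suc n. ?f (Suc n) k) = x * (\<Sum>k\<le>n. ?f n k) + y * q ^ n * (\<Sum>k\<le>n. ?f n k)" .
  show ?case
    unfolding * prod.lessThan_Suc Suc.IH by (simp only: distrib_left distrib_right mult.commute)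
qed (simp add: numeral_2_eq_2)

text \<open>The Pascal rule reduces the claim to $1 - Q^{n+1} = (1 - Q^{n-k}) + Q^{n-k} (1 -
  Q^{k+1})$.\<close>

lemma qbin_eta_fin:
  assumes "k \<le> n"
  shows "qbin (fps_X ^ d) n k * eta_fin d k * eta_fin d (n - k) = eta_fin d n"
  using assms
proof (induction n arbitrary: k)
  case (Suc n)
  show ?case
  proof (cases k)
    case [simp]: (Suc k')
    define Q :: "rat fps" where "Q = fps_X ^ d"
    have eta: "eta_fin d (Suc m) = eta_fin d m * (1 - Q * Q ^ m)" for m
      by (simp add: eta_fin_Suc Q_def power_mult power_add)
    have 1: "qbin Q n k' * eta_fin d k' * eta_fin d (n - k') = eta_fin d n"
      using Suc.IH[of k'] Suc.prems by (simp add: Q_def)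
    have 2: "qbin Q n (Suc k') * eta_fin d (Suc k') * eta_fin d (n - k') = eta_fin d n * (1 - Q ^ (n - k'))"
    proof (cases "k' = n")
      case False
      hence *: "n - k' = Suc (n - Suc k')" using Suc.prems by simp
      have "qbin Q n (Suc k') * eta_fin d (Suc k') * eta_fin d (n - Suc k') = eta_fin d n"
        using Suc.IH[of "Suc k'"] Suc.prems False by (simp add: Q_def)
      moreover have "eta_fin d (n - k') = eta_fin d (n - Suc k') * (1 - Q ^ (n - k'))"
        using * by (simp add: eta)
      ultimately show ?thesis
        by (simp only: mult.assoc[symmetric])
    qed (simp add: qbin_eq_0)
    have "qbin Q (Suc n) (Suc k') * eta_fin d (Suc k') * eta_fin d (n - k') =
            eta_fin d n * (1 - Q ^ (n - k')) +
            Q ^ (n - k') * (qbin Q n k' * eta_fin d k' * eta_fin d (n - k')) * (1 - Q * Q ^ k')"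
      unfolding qbin.simps distrib_right 2 by (simp only: eta mult_ac)
    also have "\<dots> = eta_fin d n * (1 - Q * (Q ^ (n - k') * Q ^ k'))"
      unfolding 1 by (simp add: algebra_simps)
    also have "Q ^ (n - k') * Q ^ k' = Q ^ n"
      using Suc.prems by (simp flip: power_add)
    finally show ?thesis
      by (simp add: Q_def[symmetric] eta)
  qed auto
qed auto

text \<open>Ramanujan's general theta function is ftheta e a b below: the sum over all
  integers $n$ of $e^n q^{a n(n+1)/2 + b n(n-1)/2}$ with $e = \pm 1$. The power $e^n$ is encoded by
  the parity of $n$.\<close>

definition ftheta_exp :: "nat \<Rightarrow> nat \<Rightarrow> int \<Rightarrow> nat" where
  "ftheta_exp a b n = nat (int a * (n * (n + 1) div 2) + int b * (n * (n - 1) div 2))"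

definition alt_sign :: "rat \<Rightarrow> int \<Rightarrow> rat" where
  "alt_sign e n = (if even n then 1 else e)"

lemma tri_int_nonneg: "n * (n + 1) div 2 \<ge> (0::int)" "n * (n - 1) div 2 \<ge> (0::int)"
proof -
  have "n * (n + 1) \<ge> 0" "n * (n - 1) \<ge> 0"
    by (cases "n \<ge> 0"; cases "n \<ge> 1"; auto simp: zero_le_mult_iff)+
  thus "n * (n + 1) div 2 \<ge> 0" "n * (n - 1) div 2 \<ge> 0" by auto
qed

lemma int_ftheta_exp: "int (ftheta_exp a b n) = int a * (n * (n + 1) div 2) + int b * (n * (n - 1) div 2)"
  unfolding ftheta_exp_def using tri_int_nonneg[of n] by simp

text \<open>Doubling removes \<open>div\<close>, so identities between exponents become polynomial
  identities over the integers.\<close>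

lemma int_ftheta_exp2: "2 * int (ftheta_exp a b n) = int a * (n * (n + 1)) + int b * (n * (n - 1))"
proof -
  have "2 * (n * (n + 1) div 2) = n * (n + 1)" "2 * (n * (n - 1) div 2) = n * (n - 1)"
    by auto
  thus ?thesis
    unfolding int_ftheta_exp by (metis (no_types) distrib_left mult.left_commute)
qed

text \<open>Both $n(n+1)$ and $n(n-1)$ are at least $|n|(|n|-1)$. This growth yields finite fibres
  and the precision of the triple product.\<close>

lemma ftheta_exp_ge: "2 * ftheta_exp a b n \<ge> (a + b) * (nat \<bar>n\<bar> * (nat \<bar>n\<bar> - 1))"
proof -
  define m where "m = nat \<bar>n\<bar>"
  have "int m * (int m - 1) \<le> n * (n + 1)" "int m * (int m - 1) \<le> n * (n - 1)"
    unfolding m_def by (cases "n \<ge> 0"; simp add: algebra_simps)+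
  hence "(int a + int b) * (int m * (int m - 1)) \<le> int a * (n * (n + 1)) + int b * (n * (n - 1))"
    by (simp add: distrib_right add_mono mult_left_mono)
  also have "\<dots> = int (2 * ftheta_exp a b n)"
    using int_ftheta_exp2[of a b n] by simp
  also have "int m * (int m - 1) = int (m * (m - 1))"
    by (cases m) (auto simp: algebra_simps)
  finally show ?thesis
    unfolding m_def[symmetric] by (metis of_nat_add of_nat_mult of_nat_le_iff)
qed

text \<open>This is the Cauchy binomial theorem with $2N$ factors $x + y q^{(a+b)i}$, where $x = q^{(a+b)N}$ and
  $y = e q^a$; the homogeneous form avoids negative exponents, and a common power of $q$ is cancelled
  at the end.\<close>

lemma finite_jacobi_triple:
  fixes e :: rat
  assumes e: "e * e = 1"
  defines "E \<equiv> fps_const e"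
  shows "(\<Prod>i<N. (1 + E * fps_X ^ (a + (a + b) * i)) * (1 + E * fps_X ^ (b + (a + b) * i))) =
         (\<Sum>k\<le>2*N. qbin (fps_X ^ (a + b)) (2 * N) k *
             fps_const (alt_sign e (int k - int N)) * fps_X ^ ftheta_exp a b (int k - int N))"
  (is "?L = ?R")
proof -
  define d where "d = a + b"
  let ?X = "fps_X :: rat fps"
  have EE: "E * E = 1" using e by (simp add: E_def)
  have E2: "E ^ (2 * n) = 1" for n
    by (simp add: power_mult power2_eq_square EE)
  have EN: "E ^ N * E ^ N = 1"
    using E2[of N] by (simp add: mult_2 power_add)
  \<comment> \<open>The common exponent: $aN + d N(N-1)/2$ from the first $N$ factors and $dN^2$
    from the last $N$.\<close>
  define S where "S = a * N + d * (N choose 2) + d * N * N"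
  \<comment> \<open>Here $dN = (a + di) + (b + d(N-1-i))$, so $e q^{a+di}$ can be pulled out; $e^2 =
    1$ leaves $1 + e q^{b+d(N-1-i)}$. The first half thus gives the factors with \<open>b\<close>,
    the second half those with \<open>a\<close>.\<close>
  have A: "(\<Prod>i<N. ?X ^ (d * N) + E * ?X ^ a * (?X ^ d) ^ i) =
             E ^ N * ?X ^ (a * N + d * (N choose 2)) * (\<Prod>i<N. 1 + E * ?X ^ (b + d * i))"
  proof -
    have "(\<Prod>i<N. ?X ^ (d * N) + E * ?X ^ a * (?X ^ d) ^ i) =
          (\<Prod>i<N. E * ?X ^ (a + d * i) * (1 + E * ?X ^ (b + d * (N - Suc i))))"
    proof (intro prod.cong refl)
      fix i assume "i \<in> {..<N}"
      hence "N = Suc i + (N - Suc i)" by simp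
      hence "d * N = (a + d * i) + (b + d * (N - Suc i))"
        by (metis add_mult_distrib2 d_def group_cancel.add1 group_cancel.add2 mult_Suc_right)
      hence "?X ^ (d * N) = ?X ^ (a + d * i) * ?X ^ (b + d * (N - Suc i))"
        by (simp only: power_add)
      moreover have "E * u * (1 + E * v) = E * u + (E * E) * (u * v)" for u v
        by (simp add: algebra_simps)
      ultimately show "?X ^ (d * N) + E * ?X ^ a * (?X ^ d) ^ i =
                         E * ?X ^ (a + d * i) * (1 + E * ?X ^ (b + d * (N - Suc i)))"
        by (simp add: EE power_add power_mult add.commute)
    qed
    also have "\<dots> = (\<Prod>i<N. E * ?X ^ (a + d * i)) * (\<Prod>i<N. 1 + E * ?X ^ (b + d * (N - Suc i)))"
      by (rule prod.distrib)
    also have "(\<Prod>i<N. 1 + E * ?X ^ (b + d * (N - Suc i))) = (\<Prod>i<N. 1 + E * ?X ^ (b + d * i))"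
      by (rule prod.nat_diff_reindex)
    also have "(\<Prod>i<M. E * ?X ^ (a + d * i)) = E ^ M * ?X ^ (a * M + d * (M choose 2))" for M
      by (induction M) (simp_all add: numeral_2_eq_2 power_add algebra_simps)
    finally show ?thesis .
  qed
  have B: "(\<Prod>i<N. ?X ^ (d * N) + E * ?X ^ a * (?X ^ d) ^ (N + i)) =
             ?X ^ (d * N * N) * (\<Prod>i<N. 1 + E * ?X ^ (a + d * i))"
  proof -
    have "(\<Prod>i<N. ?X ^ (d * N) + E * ?X ^ a * (?X ^ d) ^ (N + i)) =
          (\<Prod>i<N. ?X ^ (d * N) * (1 + E * ?X ^ (a + d * i)))"
      by (intro prod.cong refl) (simp add: algebra_simps power_add flip: power_mult)
    also have "\<dots> = (?X ^ (d * N)) ^ N * (\<Prod>i<N. 1 + E * ?X ^ (a + d * i))"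
      by (simp add: prod.distrib)
    finally show ?thesis by (simp only: power_mult)
  qed
  have "(\<Prod>i<2*N. ?X ^ (d * N) + E * ?X ^ a * (?X ^ d) ^ i) = E ^ N * ?X ^ S * ?L"
  proof -
    have "(\<Prod>i<2*N. ?X ^ (d * N) + E * ?X ^ a * (?X ^ d) ^ i) =
          (\<Prod>i<N. ?X ^ (d * N) + E * ?X ^ a * (?X ^ d) ^ i) *
          (\<Prod>i<N. ?X ^ (d * N) + E * ?X ^ a * (?X ^ d) ^ (N + i))"
      unfolding mult_2
      using prod.atLeastLessThan_concat[of 0 N "N + N" "\<lambda>i. ?X ^ (d * N) + E * ?X ^ a * (?X ^ d) ^ i"]
        prod.shift_bounds_nat_ivl[of "\<lambda>i. ?X ^ (d * N) + E * ?X ^ a * (?X ^ d) ^ i" 0 N N]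
      by (simp add: lessThan_atLeast0 add.commute)
    thus ?thesis
      unfolding A B by (simp add: S_def power_add prod.distrib d_def mult_ac)
  qed
  moreover have "(\<Prod>i<2*N. ?X ^ (d * N) + E * ?X ^ a * (?X ^ d) ^ i) = E ^ N * ?X ^ S * ?R"
    unfolding cauchy_binomial sum_distrib_left
  proof (intro sum.cong refl)
    fix k assume "k \<in> {..2 * N}"
    hence k: "k \<le> 2 * N" by simp
    define n where "n = int k - int N"
    have tri: "2 * int (k choose 2) = int k * (int k - 1)" for k
      by (induction k) (auto simp: numeral_2_eq_2 algebra_simps)
    have "2 * int (d * (k choose 2) + d * N * (2 * N - k) + a * k) =
            int d * (2 * int (k choose 2)) + 2 * (int d * int N * (2 * int N - int k)) + 2 * (int a * int k)"
      using k by simp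
    also have "\<dots> = 2 * (int a * int N) + int d * (2 * int (N choose 2)) + 2 * (int d * int N * int N) +
                      2 * int (ftheta_exp a b n)"
      unfolding tri int_ftheta_exp2 n_def d_def of_nat_add by algebra
    also have "\<dots> = 2 * int (S + ftheta_exp a b n)"
      by (simp add: S_def)
    finally have "2 * int (d * (k choose 2) + d * N * (2 * N - k) + a * k) = 2 * int (S + ftheta_exp a b n)" .
    hence ex: "d * (k choose 2) + d * N * (2 * N - k) + a * k = S + ftheta_exp a b n"
      by (simp only: mult_cancel_left of_nat_eq_iff) simp
    have sgn: "E ^ k = E ^ N * fps_const (alt_sign e n)"
    proof (cases "even n")
      case True
      hence "even (k + N)" unfolding n_def by presburger
      then obtain m where m: "k + N = 2 * m" by blast
      have "E ^ k = E ^ (k + N) * E ^ N"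
        by (simp only: power_add mult.assoc EN mult_1_right)
      thus ?thesis using True by (simp add: m E2 alt_sign_def)
    next
      case False
      hence "even (Suc (k + N))" unfolding n_def by presburger
      then obtain m where m: "Suc (k + N) = 2 * m" by blast
      have "E ^ k = E ^ (k + N) * (E * E) * E ^ N"
        by (simp only: EE power_add mult.assoc EN mult_1_right)
      also have "\<dots> = E ^ Suc (k + N) * E * E ^ N"
        by simp
      finally show ?thesis using False unfolding m E2 by (simp add: alt_sign_def E_def mult.commute)
    qed
    have "qbin (?X ^ d) (2 * N) k * (?X ^ d) ^ (k choose 2) * (?X ^ (d * N)) ^ (2 * N - k) * (E * ?X ^ a) ^ k =
          qbin (?X ^ d) (2 * N) k * E ^ k * ?X ^ (d * (k choose 2) + d * N * (2 * N - k) + a * k)"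
      by (simp add: power_add power_mult_distrib mult_ac flip: power_mult)
    also have "\<dots> = E ^ N * ?X ^ S * (qbin (?X ^ (a + b)) (2 * N) k * fps_const (alt_sign e n) * ?X ^ ftheta_exp a b n)"
      unfolding ex sgn d_def[symmetric] by (simp only: power_add mult_ac)
    finally show "qbin (?X ^ d) (2 * N) k * (?X ^ d) ^ (k choose 2) * (?X ^ (d * N)) ^ (2 * N - k) * (E * ?X ^ a) ^ k =
      E ^ N * ?X ^ S * (qbin (?X ^ (a + b)) (2 * N) k * fps_const (alt_sign e (int k - int N)) *
        ?X ^ ftheta_exp a b (int k - int N))"
      unfolding n_def .
  qed
  ultimately have "E ^ N * ?X ^ S * ?L = E ^ N * ?X ^ S * ?R"
    by (simp only:)
  moreover have "E ^ N * ?X ^ S \<noteq> 0"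
    using e by (auto simp: E_def)
  ultimately show ?thesis
    by (rule mult_left_cancel[THEN iffD1, rotated])
qed

section \<open>Bilateral theta series and the passage to infinite products\<close>

text \<open>The series of $c(i) q^{e(i)}$ over all integers $i$, collected by exponent. An infinite
  fibre would give coefficient 0, hence the finiteness assumption in
  \<open>bsum_split_3\<close>.\<close>

definition bsum :: "(int \<Rightarrow> rat) \<Rightarrow> (int \<Rightarrow> nat) \<Rightarrow> rat fps" where
  "bsum c e = Abs_fps (\<lambda>n. \<Sum>i | e i = n. c i)"

definition ftheta :: "rat \<Rightarrow> nat \<Rightarrow> nat \<Rightarrow> rat fps" where
  "ftheta e a b = bsum (alt_sign e) (ftheta_exp a b)"

lemma ftheta_exp_less_imp:
  assumes "a + b \<ge> 1" "ftheta_exp a b n < N"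
  shows "nat \<bar>n\<bar> \<le> N"
proof (rule ccontr)
  assume "\<not> nat \<bar>n\<bar> \<le> N"
  hence "1 * (Suc N * N) \<le> (a + b) * (nat \<bar>n\<bar> * (nat \<bar>n\<bar> - 1))"
    using assms(1) by (intro mult_mono) auto
  also have "\<dots> \<le> 2 * ftheta_exp a b n"
    by (rule ftheta_exp_ge)
  also have "\<dots> < 2 * N" using assms by simp
  finally have "Suc N < 2" by simp
  thus False using assms by auto
qed

lemma finite_ftheta_exp:
  assumes "a + b \<ge> 1"
  shows "finite {i. ftheta_exp a b i = n}"
proof (rule finite_subset)
  show "{i. ftheta_exp a b i = n} \<subseteq> {- int (Suc n)..int (Suc n)}"
    using ftheta_exp_less_imp[OF assms, of _ "Suc n"] by force
qed auto

lemma ftheta_eq_upto: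
  assumes "a + b \<ge> 1"
  shows "eq_upto N (ftheta e a b) (\<Sum>k\<le>2*N. fps_const (alt_sign e (int k - int N)) * fps_X ^ ftheta_exp a b (int k - int N))"
  unfolding eq_upto_def
proof (intro allI impI)
  fix i assume i: "i < N"
  have "fps_nth (\<Sum>k\<le>2*N. fps_const (alt_sign e (int k - int N)) * fps_X ^ ftheta_exp a b (int k - int N)) i =
          (\<Sum>k\<le>2*N. if ftheta_exp a b (int k - int N) = i then alt_sign e (int k - int N) else 0)"
    by (auto simp: fps_sum_nth intro!: sum.cong)
  also have "\<dots> = (\<Sum>k | k \<le> 2 * N \<and> ftheta_exp a b (int k - int N) = i. alt_sign e (int k - int N))"
    by (simp add: sum.If_cases atMost_def Int_def)
  also have "\<dots> = (\<Sum>n | ftheta_exp a b n = i. alt_sign e n)"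
    by (rule sum.reindex_bij_witness[where i = "\<lambda>n. nat (n + int N)" and j = "\<lambda>k. int k - int N"])
       (use ftheta_exp_less_imp[OF assms, of _ N] i in \<open>force+\<close>)
  finally show "fps_nth (ftheta e a b) i =
    fps_nth (\<Sum>k\<le>2*N. fps_const (alt_sign e (int k - int N)) * fps_X ^ ftheta_exp a b (int k - int N)) i"
    by (simp add: ftheta_def bsum_def)
qed

text \<open>Near the middle of its row a Gaussian binomial is close to $1/E(q^d)$: all finite
  products in \<open>qbin_eta_fin\<close> can be replaced by the infinite one, to an order set by
  the distance \<open>r\<close> of \<open>k\<close> from both ends.\<close>

lemma Eta_qbin:
  assumes "d \<ge> 1" "k \<le> n" "r \<le> k" "r \<le> n - k"
  shows "eq_upto (d * Suc r) (Eta d * qbin (fps_X ^ d) n k) 1"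
proof (rule eq_upto_cancel)
  let ?q = "qbin (fps_X ^ d) n k"
  have E: "eq_upto (d * Suc r) (Eta d) (eta_fin d m)" if "r \<le> m" for m
    by (rule eq_upto_mono[OF eq_upto_Eta_Suc[OF assms(1), of m]]) (use that in auto)
  have "eq_upto (d * Suc r) (?q * Eta d * Eta d) (?q * eta_fin d k * eta_fin d (n - k))"
    by (intro eq_upto_mult E eq_upto_refl assms)
  also have "?q * eta_fin d k * eta_fin d (n - k) = eta_fin d n"
    by (rule qbin_eta_fin) fact
  also have "eq_upto (d * Suc r) (eta_fin d n) (Eta d)"
    by (rule eq_upto_sym[OF E]) (use assms in auto)
  finally show "eq_upto (d * Suc r) (Eta d * (Eta d * ?q)) (Eta d * 1)"
    by (simp add: mult_ac)
qed auto

text \<open>Multiplication by \<open>Eta (a + b)\<close> turns the coefficients \<open>qbin\<close>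
  into 1 up to an error. At distance \<open>m\<close> from the centre the error has order only
  \<open>d * Suc (N - m)\<close>, but the accompanying power of $q$ has exponent at least $d
  m(m-1)/2$, which restores order $N$.\<close>

lemma jacobi_triple:
  fixes e :: rat
  assumes e: "e * e = 1" and ab: "a + b \<ge> 1"
  shows "eq_upto N (Eta (a + b) * (\<Prod>i<N. (1 + fps_const e * fps_X ^ (a + (a + b) * i)) *
           (1 + fps_const e * fps_X ^ (b + (a + b) * i)))) (ftheta e a b)"
proof -
  define d where "d = a + b"
  have d: "d \<ge> 1" using ab by (simp add: d_def)
  let ?t = "\<lambda>k. fps_const (alt_sign e (int k - int N)) * fps_X ^ ftheta_exp a b (int k - int N)"
  have "eq_upto N (\<Sum>k\<le>2*N. Eta d * (qbin (fps_X ^ d) (2 * N) k *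
             fps_const (alt_sign e (int k - int N)) * fps_X ^ ftheta_exp a b (int k - int N))) (\<Sum>k\<le>2*N. ?t k)"
  proof (rule eq_upto_sum)
    fix k assume "k \<in> {..2*N}"
    hence k: "k \<le> 2 * N" by simp
    define n where "n = int k - int N"
    define m where "m = nat \<bar>n\<bar>"
    define r where "r = N - m"
    have r: "r \<le> k" "r \<le> 2 * N - k" "N = r + m"
      using k unfolding r_def m_def n_def by linarith+
    define q where "q = Eta d * qbin (fps_X ^ d) (2 * N) k"
    have "eq_upto (d * Suc r) q 1"
      unfolding q_def by (rule Eta_qbin) (use k r d in auto)
    from eq_upto_X_power_mult[OF this, of "ftheta_exp a b n"]
    have *: "eq_upto (d * Suc r + ftheta_exp a b n) (fps_X ^ ftheta_exp a b n * q) (fps_X ^ ftheta_exp a b n)"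
      by simp
    \<comment> \<open>This is $(m-1)(m-2) \<ge> 0$; small \<open>m\<close> are separate because of
      natural subtraction.\<close>
    have "2 * m \<le> m * (m - 1) + 2"
    proof (cases "m \<le> 2")
      case True
      hence "m = 0 \<or> m = 1 \<or> m = 2" by auto
      thus ?thesis by auto
    next
      case False
      hence "m * 2 \<le> m * (m - 1)" by (intro mult_left_mono) auto
      thus ?thesis by linarith
    qed
    hence "1 * (2 * N) \<le> d * (2 * Suc r + m * (m - 1))"
      using d r(3) by (intro mult_mono) auto
    also have "\<dots> \<le> 2 * (d * Suc r + ftheta_exp a b n)"
      using ftheta_exp_ge[of a b n] unfolding m_def[symmetric] d_def[symmetric] distrib_left by linarith
    finally have "N \<le> d * Suc r + ftheta_exp a b n" by simp
    from eq_upto_mult[OF eq_upto_refl eq_upto_mono[OF * this], of "fps_const (alt_sign e n)"]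
    show "eq_upto N (Eta d * (qbin (fps_X ^ d) (2 * N) k *
             fps_const (alt_sign e (int k - int N)) * fps_X ^ ftheta_exp a b (int k - int N))) (?t k)"
      unfolding n_def[symmetric] q_def by (simp only: mult_ac)
  qed
  also have "eq_upto N (\<Sum>k\<le>2*N. ?t k) (ftheta e a b)"
    by (rule eq_upto_sym[OF ftheta_eq_upto[OF ab]])
  finally show ?thesis
    unfolding finite_jacobi_triple[OF e] sum_distrib_left d_def .
qed

section \<open>Product formulas for four theta series\<close>

lemma eta_fin_add: "eta_fin k (M + n) = eta_fin k M * (\<Prod>i<n. 1 - fps_X ^ (k * (M + Suc i)))"
  by (induction n) (simp_all add: eta_fin_Suc mult.assoc)

lemma eta_fin_mult_Suc:
  "eta_fin k (c * Suc N) = eta_fin k (c * N) * (\<Prod>i<c. 1 - fps_X ^ (k * (c * N + Suc i)))"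
  using eta_fin_add[of k "c * N" c] by (simp only: mult_Suc_right add.commute)

text \<open>\<open>F\<close> clears denominators, so that a product formula reduces to a congruence
  between finite Euler products.\<close>

lemma Eta_ftheta_eqI:
  assumes "e * e = 1" "a + b \<ge> 1"
  assumes "\<And>N. eq_upto N (F * (\<Prod>i<N. (1 + fps_const e * fps_X ^ (a + (a + b) * i)) *
             (1 + fps_const e * fps_X ^ (b + (a + b) * i)))) G"
  shows "F * ftheta e a b = Eta (a + b) * G"
proof (rule fps_eq_upto_eqI)
  fix N
  let ?P = "\<Prod>i<N. (1 + fps_const e * fps_X ^ (a + (a + b) * i)) *
             (1 + fps_const e * fps_X ^ (b + (a + b) * i))"
  have "eq_upto N (F * ftheta e a b) (F * (Eta (a + b) * ?P))"
    by (rule eq_upto_mult[OF eq_upto_refl eq_upto_sym[OF jacobi_triple]]) (rule assms)+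
  also have "F * (Eta (a + b) * ?P) = Eta (a + b) * (F * ?P)"
    by (rule mult.left_commute)
  also have "eq_upto N \<dots> (Eta (a + b) * G)"
    by (rule eq_upto_mult[OF eq_upto_refl assms(3)])
  finally show "eq_upto N (F * ftheta e a b) (Eta (a + b) * G)" .
qed

text \<open>The factor $1 + q^0$ gives the 2; what remains is the square of the product of all $1 +
  q^m$, which is $E(q^2)/E(q)$.\<close>

lemma Eta_ftheta_0_1: "Eta 1 * ftheta 1 0 1 = 2 * Eta 2 ^ 2"
proof -
  let ?X = "fps_X :: rat fps"
  have "Eta 1 ^ 2 * ftheta 1 0 1 = Eta (0 + 1) * (2 * Eta 2 ^ 2)"
  proof (rule Eta_ftheta_eqI)
    fix N
    have 1: "(\<Prod>i<N. 1 + ?X ^ i) * (1 + ?X ^ N) = 2 * (\<Prod>i<N. 1 + ?X ^ Suc i)"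
      by (induction N) (simp_all add: mult_ac)
    have 2: "eta_fin 1 N * (\<Prod>i<N. 1 + ?X ^ Suc i) = eta_fin 2 N"
    proof (induction N)
      case (Suc N)
      have "1 - ?X ^ (2 * Suc N) = (1 - ?X ^ (1 * Suc N)) * (1 + ?X ^ Suc N)"
        unfolding mult_2 power_add mult_1_left by algebra
      thus ?case by (simp only: eta_fin_Suc prod.lessThan_Suc flip: Suc) (simp only: mult_ac)
    qed simp
    define P where "P = (\<Prod>i<N. (1 + fps_const 1 * ?X ^ (0 + (0 + 1) * i)) * (1 + fps_const 1 * ?X ^ (1 + (0 + 1) * i)))"
    have P: "P = (\<Prod>i<N. 1 + ?X ^ i) * (\<Prod>i<N. 1 + ?X ^ Suc i)"
      by (simp add: P_def prod.distrib)
    \<comment> \<open>Congruent to 1 modulo $q^N$, this factor is inserted to shift the product of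
      $1 + q^i$ over \<open>i < N\<close> by one.\<close>
    have "eq_upto N 1 (1 + ?X ^ N)"
      by (simp add: eq_upto_def)
    hence "eq_upto N (Eta 1 ^ 2 * P * 1) (eta_fin 1 N ^ 2 * P * (1 + ?X ^ N))"
      by (intro eq_upto_mult eq_upto_refl eq_upto_power eq_upto_Eta) auto
    also have "eta_fin 1 N ^ 2 * P * (1 + ?X ^ N) =
                 eta_fin 1 N ^ 2 * (\<Prod>i<N. 1 + ?X ^ Suc i) * ((\<Prod>i<N. 1 + ?X ^ i) * (1 + ?X ^ N))"
      unfolding P by (simp only: mult_ac)
    also have "\<dots> = 2 * (eta_fin 1 N * (\<Prod>i<N. 1 + ?X ^ Suc i)) ^ 2"
      unfolding 1 by (simp only: power2_eq_square mult_ac)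
    also have "eq_upto N \<dots> (2 * Eta 2 ^ 2)"
      unfolding 2 by (intro eq_upto_mult[OF eq_upto_refl] eq_upto_power eq_upto_sym[OF eq_upto_Eta]) auto
    finally show "eq_upto N (Eta 1 ^ 2 * (\<Prod>i<N. (1 + fps_const 1 * ?X ^ (0 + (0 + 1) * i)) *
        (1 + fps_const 1 * ?X ^ (1 + (0 + 1) * i)))) (2 * Eta 2 ^ 2)"
      by (simp only: P_def mult_1_right)
  qed auto
  hence "Eta 1 * (Eta 1 * ftheta 1 0 1) = Eta 1 * (2 * Eta 2 ^ 2)"
    by (simp only: power2_eq_square mult.assoc add_0)
  thus ?thesis
    by (rule mult_left_cancel[THEN iffD1, rotated]) (rule Eta_nonzero)
qed

text \<open>The product of $1 - q^m$ over odd $m$ is $E(q)/E(q^2)$; it occurs squared.\<close>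

lemma Eta_ftheta_1_1: "Eta 2 * ftheta (-1) 1 1 = Eta 1 ^ 2"
proof -
  let ?X = "fps_X :: rat fps"
  have "Eta 2 ^ 2 * ftheta (-1) 1 1 = Eta (1 + 1) * (Eta 1 ^ 2)"
  proof (rule Eta_ftheta_eqI)
    fix N
    have 1: "eta_fin 2 N * (\<Prod>i<N. 1 - ?X ^ (1 + 2 * i)) = eta_fin 1 (2 * N)"
    proof (induction N)
      case (Suc N)
      show ?case
        unfolding eta_fin_mult_Suc Suc[symmetric] eta_fin_Suc
        by (simp add: numeral_2_eq_2 mult_ac)
    qed simp
    define P where "P = (\<Prod>i<N. (1 + fps_const (-1) * ?X ^ (1 + (1 + 1) * i)) * (1 + fps_const (-1) * ?X ^ (1 + (1 + 1) * i)))"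
    have P: "P = (\<Prod>i<N. 1 - ?X ^ (1 + 2 * i)) ^ 2"
      by (simp add: P_def prod.distrib power2_eq_square numeral_2_eq_2 fps_const_neg[symmetric] del: fps_const_neg)
    have "eq_upto N (Eta 2 ^ 2 * P) (eta_fin 2 N ^ 2 * P)"
      by (intro eq_upto_mult eq_upto_refl eq_upto_power eq_upto_Eta) auto
    also have "eta_fin 2 N ^ 2 * P = eta_fin 1 (2 * N) ^ 2"
      unfolding P 1[symmetric] by (simp only: power_mult_distrib)
    also have "eq_upto N \<dots> (Eta 1 ^ 2)"
      by (intro eq_upto_power eq_upto_sym[OF eq_upto_Eta]) auto
    finally show "eq_upto N (Eta 2 ^ 2 * (\<Prod>i<N. (1 + fps_const (-1) * ?X ^ (1 + (1 + 1) * i)) *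
        (1 + fps_const (-1) * ?X ^ (1 + (1 + 1) * i)))) (Eta 1 ^ 2)"
      by (simp only: P_def)
  qed auto
  hence "Eta 2 * (Eta 2 * ftheta (-1) 1 1) = Eta 2 * Eta 1 ^ 2"
    by (simp only: power2_eq_square mult.assoc one_add_one)
  thus ?thesis
    by (rule mult_left_cancel[THEN iffD1, rotated]) (rule Eta_nonzero)
qed

lemma prod_lessThan_2: "(\<Prod>i<2. f i) = f 0 * f (1::nat)"
  by (simp add: numeral_2_eq_2)

lemma prod_lessThan_3: "(\<Prod>i<3. f i) = f 0 * f 1 * f (2::nat)"
  by (simp add: numeral_3_eq_3 numeral_2_eq_2)

lemma prod_lessThan_6: "(\<Prod>i<6. f i) = f 0 * f 1 * f 2 * f 3 * f 4 * f (5::nat)"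
  by (simp add: numeral_eq_Suc)

text \<open>The product of $1 + q^m$ over $m$ prime to 3 is $E(q^2)/E(q)$ divided by the same
  quotient at $q^3$.\<close>

lemma Eta_ftheta_1_2: "Eta 1 * Eta 6 * ftheta 1 1 2 = Eta 2 * Eta 3 ^ 2"
proof -
  let ?X = "fps_X :: rat fps"
  have "Eta 1 * Eta 6 * ftheta 1 1 2 = Eta (1 + 2) * (Eta 2 * Eta 3)"
  proof (rule Eta_ftheta_eqI)
    fix N
    define P where "P = (\<lambda>N. \<Prod>i<N. (1 + fps_const 1 * ?X ^ (1 + (1 + 2) * i)) * (1 + fps_const 1 * ?X ^ (2 + (1 + 2) * i)))"
    have 1: "eta_fin 1 (3 * N) * eta_fin 6 N * P N = eta_fin 2 (3 * N) * eta_fin 3 N"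
    proof (induction N)
      case (Suc N)
      define u v w where "u = ?X ^ (3 * N + 1)" "v = ?X ^ (3 * N + 2)" "w = ?X ^ (3 * N + 3)"
      have ex: "1 * (3 * N + Suc 0) = 3 * N + 1" "1 * (3 * N + Suc 1) = 3 * N + 2" "1 * (3 * N + Suc 2) = 3 * N + 3"
        "2 * (3 * N + Suc 0) = (3 * N + 1) * 2" "2 * (3 * N + Suc 1) = (3 * N + 2) * 2"
        "2 * (3 * N + Suc 2) = (3 * N + 3) * 2" "3 * Suc N = 3 * N + 3" "6 * Suc N = (3 * N + 3) * 2"
        "1 + (1 + 2) * N = 3 * N + 1" "2 + (1 + 2) * N = 3 * N + 2"
        by simp_all
      have "eta_fin 1 (3 * Suc N) = eta_fin 1 (3 * N) * ((1 - u) * (1 - v) * (1 - w))"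
        unfolding eta_fin_mult_Suc by (simp only: prod_lessThan_3 ex u_v_w_def)
      moreover have f2: "eta_fin 2 (3 * Suc N) = eta_fin 2 (3 * N) * ((1 - u ^ 2) * (1 - v ^ 2) * (1 - w ^ 2))"
        unfolding eta_fin_mult_Suc by (simp only: prod_lessThan_3 ex u_v_w_def) (simp only: power_mult)
      moreover have f3: "eta_fin 3 (Suc N) = eta_fin 3 N * (1 - w)"
        by (simp only: eta_fin_Suc ex u_v_w_def)
      moreover have "eta_fin 6 (Suc N) = eta_fin 6 N * (1 - w ^ 2)"
        by (simp only: eta_fin_Suc ex u_v_w_def) (simp only: power_mult)
      moreover have "P (Suc N) = P N * ((1 + u) * (1 + v))"
        by (simp only: P_def prod.lessThan_Suc ex u_v_w_def fps_const_1_eq_1 mult_1_left)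
      ultimately have "eta_fin 1 (3 * Suc N) * eta_fin 6 (Suc N) * P (Suc N) =
          (eta_fin 1 (3 * N) * eta_fin 6 N * P N) * ((1 - u) * (1 - v) * (1 - w) * (1 - w ^ 2) * ((1 + u) * (1 + v)))"
        by (simp only: mult_ac)
      also have "\<dots> = eta_fin 2 (3 * N) * eta_fin 3 N * (((1 - u ^ 2) * (1 - v ^ 2) * (1 - w ^ 2)) * (1 - w))"
        unfolding Suc by algebra
      also have "\<dots> = eta_fin 2 (3 * Suc N) * eta_fin 3 (Suc N)"
        unfolding f2 f3 by (simp only: mult_ac)
      finally show ?case .
    qed (simp add: P_def)
    have "eq_upto N (Eta 1 * Eta 6 * P N) (eta_fin 1 (3 * N) * eta_fin 6 N * P N)"
      by (intro eq_upto_mult eq_upto_refl eq_upto_Eta) auto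
    also note 1
    also have "eq_upto N (eta_fin 2 (3 * N) * eta_fin 3 N) (Eta 2 * Eta 3)"
      by (intro eq_upto_mult eq_upto_sym[OF eq_upto_Eta]) auto
    finally show "eq_upto N (Eta 1 * Eta 6 * (\<Prod>i<N. (1 + fps_const 1 * ?X ^ (1 + (1 + 2) * i)) *
        (1 + fps_const 1 * ?X ^ (2 + (1 + 2) * i)))) (Eta 2 * Eta 3)"
      by (simp only: P_def)
  qed auto
  moreover have "(1::nat) + 2 = 3" by simp
  ultimately show ?thesis
    by (simp only: power2_eq_square mult_ac)
qed

text \<open>By inclusion and exclusion the product of $1 - q^m$ over $m$ prime to 6 is $E(q) E(q^6)
  / (E(q^2) E(q^3))$. The different truncations all stop at exponent $6N$.\<close>

lemma Eta_ftheta_1_5: "Eta 2 * Eta 3 * ftheta (-1) 1 5 = Eta 1 * Eta 6 ^ 2"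
proof -
  let ?X = "fps_X :: rat fps"
  have "Eta 2 * Eta 3 * ftheta (-1) 1 5 = Eta (1 + 5) * (Eta 1 * Eta 6)"
  proof (rule Eta_ftheta_eqI)
    fix N
    define P where "P = (\<lambda>N. \<Prod>i<N. (1 + fps_const (-1) * ?X ^ (1 + (1 + 5) * i)) * (1 + fps_const (-1) * ?X ^ (5 + (1 + 5) * i)))"
    have 1: "eta_fin 2 (3 * N) * eta_fin 3 (2 * N) * P N = eta_fin 1 (6 * N) * eta_fin 6 N"
    proof (induction N)
      case (Suc N)
      define u :: "nat \<Rightarrow> rat fps" where "u = (\<lambda>j. 1 - ?X ^ (6 * N + j))"
      have ex: "1 * (6 * N + Suc 0) = 6 * N + 1" "1 * (6 * N + Suc 1) = 6 * N + 2" "1 * (6 * N + Suc 2) = 6 * N + 3"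
        "1 * (6 * N + Suc 3) = 6 * N + 4" "1 * (6 * N + Suc 4) = 6 * N + 5" "1 * (6 * N + Suc 5) = 6 * N + 6"
        "2 * (3 * N + Suc 0) = 6 * N + 2" "2 * (3 * N + Suc 1) = 6 * N + 4" "2 * (3 * N + Suc 2) = 6 * N + 6"
        "3 * (2 * N + Suc 0) = 6 * N + 3" "3 * (2 * N + Suc 1) = 6 * N + 6" "6 * Suc N = 6 * N + 6"
        "1 + (1 + 5) * N = 6 * N + 1" "5 + (1 + 5) * N = 6 * N + 5"
        by simp_all
      have f1: "eta_fin 1 (6 * Suc N) = eta_fin 1 (6 * N) * (u 1 * u 2 * u 3 * u 4 * u 5 * u 6)"
        unfolding eta_fin_mult_Suc by (simp only: prod_lessThan_6 ex u_def)
      moreover have "eta_fin 2 (3 * Suc N) = eta_fin 2 (3 * N) * (u 2 * u 4 * u 6)"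
        unfolding eta_fin_mult_Suc by (simp only: prod_lessThan_3 ex u_def)
      moreover have "eta_fin 3 (2 * Suc N) = eta_fin 3 (2 * N) * (u 3 * u 6)"
        unfolding eta_fin_mult_Suc by (simp only: prod_lessThan_2 ex u_def)
      moreover have f6: "eta_fin 6 (Suc N) = eta_fin 6 N * u 6"
        by (simp only: eta_fin_Suc ex u_def)
      moreover have neg: "1 + fps_const (-1) * f = 1 - f" for f :: "rat fps"
        by (simp flip: fps_const_neg)
      have "P (Suc N) = P N * (u 1 * u 5)"
        by (simp only: P_def prod.lessThan_Suc ex u_def neg)
      ultimately have "eta_fin 2 (3 * Suc N) * eta_fin 3 (2 * Suc N) * P (Suc N) =
          (eta_fin 2 (3 * N) * eta_fin 3 (2 * N) * P N) * (u 1 * u 2 * u 3 * u 4 * u 5 * u 6 * u 6)"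
        by (simp only: mult_ac)
      also have "\<dots> = eta_fin 1 (6 * Suc N) * eta_fin 6 (Suc N)"
        unfolding Suc f1 f6 by (simp only: mult_ac)
      finally show ?case .
    qed (simp add: P_def)
    have "eq_upto N (Eta 2 * Eta 3 * P N) (eta_fin 2 (3 * N) * eta_fin 3 (2 * N) * P N)"
      by (intro eq_upto_mult eq_upto_refl eq_upto_Eta) auto
    also note 1
    also have "eq_upto N (eta_fin 1 (6 * N) * eta_fin 6 N) (Eta 1 * Eta 6)"
      by (intro eq_upto_mult eq_upto_sym[OF eq_upto_Eta]) auto
    finally show "eq_upto N (Eta 2 * Eta 3 * (\<Prod>i<N. (1 + fps_const (-1) * ?X ^ (1 + (1 + 5) * i)) *
        (1 + fps_const (-1) * ?X ^ (5 + (1 + 5) * i)))) (Eta 1 * Eta 6)"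
      by (simp only: P_def)
  qed auto
  thus ?thesis
    by (simp add: power2_eq_square mult_ac)
qed

section \<open>Three-dissections\<close>

text \<open>The third class is written $3i-1$, not $3i+2$, so that exponents in the dissections
  below match up to $i \<mapsto> -i$ without a shift.\<close>

lemma bsum_split_3:
  assumes fin: "\<And>n. finite {i. e i = n}"
  shows "bsum c e = bsum (\<lambda>i. c (3 * i)) (\<lambda>i. e (3 * i)) + bsum (\<lambda>i. c (3 * i + 1)) (\<lambda>i. e (3 * i + 1)) +
           bsum (\<lambda>i. c (3 * i - 1)) (\<lambda>i. e (3 * i - 1))"
proof (rule fps_ext)
  fix n
  let ?A = "\<lambda>r. {i. e i = n \<and> i mod 3 = r}"
  have fin': "finite (?A r)" for r
    by (rule finite_subset[OF _ fin[of n]]) (rule subsetI, simp only: mem_Collect_eq)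
  have "i mod 3 = 0 \<or> i mod 3 = 1 \<or> i mod 3 = 2" for i :: int
    by presburger
  hence "{i. e i = n} = (?A 0 \<union> ?A 1) \<union> ?A 2" by blast
  hence "(\<Sum>i | e i = n. c i) = sum c ((?A 0 \<union> ?A 1) \<union> ?A 2)" by (simp only:)
  also have "\<dots> = sum c (?A 0 \<union> ?A 1) + sum c (?A 2)"
    by (rule sum.union_disjoint) (use fin' in auto)
  also have "sum c (?A 0 \<union> ?A 1) = sum c (?A 0) + sum c (?A 1)"
    by (rule sum.union_disjoint) (use fin' in auto)
  also have "sum c (?A 0) = (\<Sum>i | e (3 * i) = n. c (3 * i))"
  proof (rule sum.reindex_bij_witness[of _ "\<lambda>i. 3 * i" "\<lambda>i. i div 3"])
    fix i assume i: "i \<in> ?A 0"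
    hence "i mod 3 = 0" by blast
    hence *: "3 * (i div 3) = i" by presburger
    show "3 * (i div 3) = i" "i div 3 \<in> {i. e (3 * i) = n}" "c (3 * (i div 3)) = c i"
      using i by (simp_all only: mem_Collect_eq *)
  qed auto
  also have "sum c (?A 1) = (\<Sum>i | e (3 * i + 1) = n. c (3 * i + 1))"
  proof (rule sum.reindex_bij_witness[of _ "\<lambda>i. 3 * i + 1" "\<lambda>i. i div 3"])
    fix i assume i: "i \<in> ?A 1"
    hence "i mod 3 = 1" by blast
    hence *: "3 * (i div 3) + 1 = i" by presburger
    show "3 * (i div 3) + 1 = i" "i div 3 \<in> {i. e (3 * i + 1) = n}" "c (3 * (i div 3) + 1) = c i"
      using i by (simp_all only: mem_Collect_eq *)
  next
    fix i assume i: "i \<in> {i. e (3 * i + 1) = n}"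
    show "(3 * i + 1) div 3 = i" by simp
    show "3 * i + 1 \<in> ?A 1" using i by simp
  qed
  also have "sum c (?A 2) = (\<Sum>i | e (3 * i - 1) = n. c (3 * i - 1))"
  proof (rule sum.reindex_bij_witness[of _ "\<lambda>i. 3 * i - 1" "\<lambda>i. (i + 1) div 3"])
    fix i assume i: "i \<in> ?A 2"
    hence "i mod 3 = 2" by blast
    hence *: "3 * ((i + 1) div 3) - 1 = i" by presburger
    show "3 * ((i + 1) div 3) - 1 = i" "(i + 1) div 3 \<in> {i. e (3 * i - 1) = n}"
      "c (3 * ((i + 1) div 3) - 1) = c i"
      using i by (simp_all only: mem_Collect_eq *)
  next
    fix i assume i: "i \<in> {i. e (3 * i - 1) = n}"
    have "(3 * i - 1) mod 3 = (3 * (i - 1) + 2) mod 3" by (simp add: algebra_simps)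
    also have "\<dots> = 2" by (simp only: mod_mult_self4) simp
    finally show "3 * i - 1 \<in> ?A 2" using i by simp
    show "(3 * i - 1 + 1) div 3 = i" by simp
  qed
  finally show "fps_nth (bsum c e) n = fps_nth (bsum (\<lambda>i. c (3 * i)) (\<lambda>i. e (3 * i)) +
      bsum (\<lambda>i. c (3 * i + 1)) (\<lambda>i. e (3 * i + 1)) + bsum (\<lambda>i. c (3 * i - 1)) (\<lambda>i. e (3 * i - 1))) n"
    by (simp add: bsum_def)
qed

lemma bsum_uminus: "bsum (\<lambda>i. c (- i)) (\<lambda>i. e (- i)) = bsum c e"
  unfolding bsum_def
  by (intro arg_cong[where f = Abs_fps] ext sum.reindex_bij_witness[of _ uminus uminus]) auto

lemma bsum_dilate:
  assumes "d > 0"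
  shows "bsum c (\<lambda>i. d * e i) = fps_dilate d (bsum c e)"
proof (rule fps_ext)
  fix n
  show "fps_nth (bsum c (\<lambda>i. d * e i)) n = fps_nth (fps_dilate d (bsum c e)) n"
  proof (cases "d dvd n")
    case True
    then obtain m where "n = d * m" by blast
    thus ?thesis using assms by (simp add: bsum_def fps_dilate_nth)
  next
    case False
    hence "{i. d * e i = n} = {}" by auto
    thus ?thesis using False by (simp add: bsum_def fps_dilate_nth)
  qed
qed

lemma bsum_Suc: "bsum c (\<lambda>i. Suc (e i)) = fps_X * bsum c e"
proof (rule fps_ext)
  fix n
  show "fps_nth (bsum c (\<lambda>i. Suc (e i))) n = fps_nth (fps_X * bsum c e) n"
    by (cases n) (simp_all add: bsum_def)
qed

lemma bsum_neg: "bsum (\<lambda>i. - c i) e = - bsum c e"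
  by (rule fps_ext) (simp add: bsum_def sum_negf)

text \<open>The exponent $n(n-1)/2$ is invariant under $n \<mapsto> 1-n$. This swaps the classes
  $3i$ and $3i+1$, whence the 2, and preserves the class $3i-1$, where the exponent is $9 i(i-1)/2 +
  1$.\<close>

lemma ftheta_0_1_dissection:
  "ftheta 1 0 1 = 2 * fps_dilate 3 (ftheta 1 1 2) + fps_X * fps_dilate 9 (ftheta 1 0 1)"
proof -
  let ?s = "alt_sign 1"
  have s: "?s i = 1" for i by (simp add: alt_sign_def)
  have e0: "ftheta_exp 0 1 (3 * i) = 3 * ftheta_exp 1 2 i" for i
  proof -
    have "2 * int (ftheta_exp 0 1 (3 * i)) = 3 * (2 * int (ftheta_exp 1 2 i))"
      by (simp only: int_ftheta_exp2 of_nat_0 of_nat_1 of_nat_numeral) algebra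
    thus ?thesis by simp
  qed
  have e1: "ftheta_exp 0 1 (3 * i + 1) = 3 * ftheta_exp 1 2 (- i)" for i
  proof -
    have "2 * int (ftheta_exp 0 1 (3 * i + 1)) = 3 * (2 * int (ftheta_exp 1 2 (- i)))"
      by (simp only: int_ftheta_exp2 of_nat_0 of_nat_1 of_nat_numeral) algebra
    thus ?thesis by simp
  qed
  have e2: "ftheta_exp 0 1 (3 * i - 1) = Suc (9 * ftheta_exp 0 1 i)" for i
  proof -
    have "2 * int (ftheta_exp 0 1 (3 * i - 1)) = 9 * (2 * int (ftheta_exp 0 1 i)) + 2"
      by (simp only: int_ftheta_exp2 of_nat_0 of_nat_1 of_nat_numeral) algebra
    thus ?thesis by simp
  qed
  have fin: "finite {i. ftheta_exp 0 1 i = n}" for n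
    by (rule finite_ftheta_exp) simp
  have "ftheta 1 0 1 = bsum (\<lambda>i. 1) (\<lambda>i. 3 * ftheta_exp 1 2 i) + bsum (\<lambda>i. 1) (\<lambda>i. 3 * ftheta_exp 1 2 (- i)) +
         bsum (\<lambda>i. 1) (\<lambda>i. Suc (9 * ftheta_exp 0 1 i))"
    unfolding ftheta_def by (subst bsum_split_3[OF fin]) (simp only: s e0 e1 e2)
  also have "bsum (\<lambda>i. 1) (\<lambda>i. 3 * ftheta_exp 1 2 (- i)) = bsum (\<lambda>i. 1) (\<lambda>i. 3 * ftheta_exp 1 2 i)"
    by (rule bsum_uminus[of "\<lambda>i. 1" "\<lambda>i. 3 * ftheta_exp 1 2 i"])
  also have "bsum (\<lambda>i. 1) (\<lambda>i. 3 * ftheta_exp 1 2 i) = fps_dilate 3 (ftheta 1 1 2)"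
    unfolding ftheta_def s[abs_def] by (rule bsum_dilate) simp
  also have "bsum (\<lambda>i. 1) (\<lambda>i. Suc (9 * ftheta_exp 0 1 i)) = fps_X * bsum (\<lambda>i. 1) (\<lambda>i. 9 * ftheta_exp 0 1 i)"
    by (rule bsum_Suc)
  also have "bsum (\<lambda>i. 1) (\<lambda>i. 9 * ftheta_exp 0 1 i) = fps_dilate 9 (ftheta 1 0 1)"
    unfolding ftheta_def s[abs_def] by (rule bsum_dilate) simp
  also have "fps_dilate 3 (ftheta 1 1 2) + fps_dilate 3 (ftheta 1 1 2) + fps_X * fps_dilate 9 (ftheta 1 0 1) =
      2 * fps_dilate 3 (ftheta 1 1 2) + fps_X * fps_dilate 9 (ftheta 1 0 1)"
    by simp
  finally show ?thesis .
qed

text \<open>The exponents are squares, so the classes $3i+1$ and $3i-1$ agree under $n \<mapsto>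
  -n$. Their members have parity opposite to $i$, whence $-2$.\<close>

lemma ftheta_1_1_dissection:
  "ftheta (-1) 1 1 = fps_dilate 9 (ftheta (-1) 1 1) - 2 * fps_X * fps_dilate 3 (ftheta (-1) 1 5)"
proof -
  let ?s = "alt_sign (-1)"
  have s: "?s (3 * i) = ?s i" "?s (3 * i + 1) = - ?s (- i)" "?s (3 * i - 1) = - ?s i" for i
    by (simp_all add: alt_sign_def)
  have e0: "ftheta_exp 1 1 (3 * i) = 9 * ftheta_exp 1 1 i" for i
  proof -
    have "2 * int (ftheta_exp 1 1 (3 * i)) = 9 * (2 * int (ftheta_exp 1 1 i))"
      by (simp only: int_ftheta_exp2 of_nat_0 of_nat_1 of_nat_numeral) algebra
    thus ?thesis by simp
  qed
  have e1: "ftheta_exp 1 1 (3 * i + 1) = Suc (3 * ftheta_exp 1 5 (- i))" for i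
  proof -
    have "2 * int (ftheta_exp 1 1 (3 * i + 1)) = 3 * (2 * int (ftheta_exp 1 5 (- i))) + 2"
      by (simp only: int_ftheta_exp2 of_nat_0 of_nat_1 of_nat_numeral) algebra
    thus ?thesis by simp
  qed
  have e2: "ftheta_exp 1 1 (3 * i - 1) = Suc (3 * ftheta_exp 1 5 i)" for i
  proof -
    have "2 * int (ftheta_exp 1 1 (3 * i - 1)) = 3 * (2 * int (ftheta_exp 1 5 i)) + 2"
      by (simp only: int_ftheta_exp2 of_nat_0 of_nat_1 of_nat_numeral) algebra
    thus ?thesis by simp
  qed
  have fin: "finite {i. ftheta_exp 1 1 i = n}" for n
    by (rule finite_ftheta_exp) simp
  have "ftheta (-1) 1 1 = bsum ?s (\<lambda>i. 9 * ftheta_exp 1 1 i) + bsum (\<lambda>i. - ?s (- i)) (\<lambda>i. Suc (3 * ftheta_exp 1 5 (- i))) +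
         bsum (\<lambda>i. - ?s i) (\<lambda>i. Suc (3 * ftheta_exp 1 5 i))"
    unfolding ftheta_def by (subst bsum_split_3[OF fin]) (simp only: s e0 e1 e2)
  also have "bsum (\<lambda>i. - ?s (- i)) (\<lambda>i. Suc (3 * ftheta_exp 1 5 (- i))) = bsum (\<lambda>i. - ?s i) (\<lambda>i. Suc (3 * ftheta_exp 1 5 i))"
    by (rule bsum_uminus[of "\<lambda>i. - ?s i" "\<lambda>i. Suc (3 * ftheta_exp 1 5 i)"])
  also have "bsum (\<lambda>i. - ?s i) (\<lambda>i. Suc (3 * ftheta_exp 1 5 i)) = fps_X * bsum (\<lambda>i. - ?s i) (\<lambda>i. 3 * ftheta_exp 1 5 i)"
    by (rule bsum_Suc)
  also have "bsum (\<lambda>i. - ?s i) (\<lambda>i. 3 * ftheta_exp 1 5 i) = - bsum ?s (\<lambda>i. 3 * ftheta_exp 1 5 i)"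
    by (rule bsum_neg)
  also have "bsum ?s (\<lambda>i. 3 * ftheta_exp 1 5 i) = fps_dilate 3 (ftheta (-1) 1 5)"
    unfolding ftheta_def by (rule bsum_dilate) simp
  also have "bsum ?s (\<lambda>i. 9 * ftheta_exp 1 1 i) = fps_dilate 9 (ftheta (-1) 1 1)"
    unfolding ftheta_def by (rule bsum_dilate) simp
  also have "fps_dilate 9 (ftheta (-1) 1 1) + fps_X * - fps_dilate 3 (ftheta (-1) 1 5) +
      fps_X * - fps_dilate 3 (ftheta (-1) 1 5) =
      fps_dilate 9 (ftheta (-1) 1 1) - 2 * fps_X * fps_dilate 3 (ftheta (-1) 1 5)"
    by simp
  finally show ?thesis .
qed

section \<open>Identities of levels 6 and 12\<close>

text \<open>Moves eta quotients into the field of Laurent series, where denominators can be cleared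
  freely.\<close>

lemma fps_to_fls_divide_unit:
  fixes f g :: "'a::field fps"
  assumes "fps_nth g 0 \<noteq> 0"
  shows "fps_to_fls (f / g) = fps_to_fls f / fps_to_fls g"
proof -
  have "f / g * g = f"
    using assms by (simp add: fps_divide_unit mult.assoc inverse_mult_eq_1)
  hence "fps_to_fls (f / g) * fps_to_fls g = fps_to_fls f"
    by (metis fls_times_fps_to_fls)
  moreover have "fps_to_fls g \<noteq> 0"
    using assms by auto
  ultimately show ?thesis
    by (simp add: eq_divide_eq)
qed

text \<open>In the classical notation these are $\varphi(-q)$, $\psi(q)$, $f(q,q^2)$ and $f(-q,-q^5)$.\<close>

definition phi_fps :: "rat fps" where "phi_fps = Eta 1 ^ 2 / Eta 2"
definition psi_fps :: "rat fps" where "psi_fps = Eta 2 ^ 2 / Eta 1"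
definition theta_A :: "rat fps" where "theta_A = Eta 2 * Eta 3 ^ 2 / (Eta 1 * Eta 6)"
definition theta_B :: "rat fps" where "theta_B = Eta 1 * Eta 6 ^ 2 / (Eta 2 * Eta 3)"

lemma ftheta_eq:
  "ftheta 1 0 1 = 2 * psi_fps" "ftheta (-1) 1 1 = phi_fps"
  "ftheta 1 1 2 = theta_A" "ftheta (-1) 1 5 = theta_B"
proof -
  have *: "f = h / g" if "g * f = h" "g \<noteq> 0" for f g h :: "rat fps"
    using that by auto
  show "ftheta (-1) 1 1 = phi_fps" "ftheta 1 1 2 = theta_A" "ftheta (-1) 1 5 = theta_B"
    unfolding phi_fps_def theta_A_def theta_B_def
    by (rule *; simp add: Eta_ftheta_1_1[simplified] Eta_ftheta_1_2[simplified] Eta_ftheta_1_5[simplified])+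
  have "ftheta 1 0 1 = 2 * Eta 2 ^ 2 / Eta 1"
    by (rule *[OF Eta_ftheta_0_1]) simp
  thus "ftheta 1 0 1 = 2 * psi_fps"
    by (simp add: psi_fps_def fps_divide_unit mult.assoc)
qed

lemma psi_dissection: "psi_fps = fps_dilate 3 theta_A + fps_X * fps_dilate 3 (fps_dilate 3 psi_fps)"
proof -
  have "2 * psi_fps = 2 * fps_dilate 3 theta_A + fps_X * fps_dilate 9 (2 * psi_fps)"
    using ftheta_0_1_dissection unfolding ftheta_eq .
  also have "fps_dilate 9 (2 * psi_fps) = 2 * fps_dilate 3 (fps_dilate 3 psi_fps)"
    by (simp add: fps_dilate_dilate fps_dilate_mult fps_dilate_numeral)
  finally have "2 * psi_fps = 2 * (fps_dilate 3 theta_A + fps_X * fps_dilate 3 (fps_dilate 3 psi_fps))"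
    by (simp only: distrib_left mult.left_commute)
  thus ?thesis
    by (rule mult_left_cancel[THEN iffD1, rotated]) simp
qed

lemma phi_dissection: "phi_fps = fps_dilate 3 (fps_dilate 3 phi_fps) - 2 * fps_X * fps_dilate 3 theta_B"
  using ftheta_1_1_dissection unfolding ftheta_eq by (simp only: fps_dilate_dilate) simp

section \<open>The norm attached to the 3-dissection\<close>

definition third_part :: "nat \<Rightarrow> rat fps \<Rightarrow> rat fps" where
  "third_part r f = Abs_fps (\<lambda>n. fps_nth f (3 * n + r))"

lemma third_part_nth: "fps_nth (third_part r f) n = fps_nth f (3 * n + r)"
  by (simp add: third_part_def)

lemma third_part_eqI:
  assumes "f = fps_dilate 3 a + fps_X * fps_dilate 3 b + fps_X ^ 2 * fps_dilate 3 c"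
  shows "third_part 0 f = a" "third_part 1 f = b" "third_part 2 f = c"
proof -
  have nd: "\<not> 3 dvd 3 * n + 1" "\<not> 3 dvd 3 * n + 2" "3 * n > 0 \<Longrightarrow> \<not> 3 dvd 3 * n - 1" "3 * n > 1 \<Longrightarrow> \<not> 3 dvd 3 * n - 2" for n :: nat
    by presburger+
  show "third_part 0 f = a" "third_part 1 f = b" "third_part 2 f = c"
    unfolding assms
    by (rule fps_ext, use nd in \<open>simp add: third_part_nth fps_dilate_nth fps_X_power_mult_nth\<close>)+
qed

lemma third_part_dissection:
  "f = fps_dilate 3 (third_part 0 f) + fps_X * fps_dilate 3 (third_part 1 f) + fps_X ^ 2 * fps_dilate 3 (third_part 2 f)"
proof (rule fps_ext)
  fix n :: nat
  have "n mod 3 = 0 \<or> n mod 3 = 1 \<or> n mod 3 = 2" by presburger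
  then obtain m where m: "n = 3 * m \<or> n = 3 * m + 1 \<or> n = 3 * m + 2"
    by (metis mult_div_mod_eq add_0_right)
  have nd: "\<not> 3 dvd 3 * m + 1" "\<not> 3 dvd 3 * m + 2" "3 * m > 0 \<Longrightarrow> \<not> 3 dvd 3 * m - 1" "3 * m > 1 \<Longrightarrow> \<not> 3 dvd 3 * m - 2"
    by presburger+
  show "fps_nth f n = fps_nth (fps_dilate 3 (third_part 0 f) + fps_X * fps_dilate 3 (third_part 1 f) +
          fps_X ^ 2 * fps_dilate 3 (third_part 2 f)) n"
    using m nd by (elim disjE) (simp_all add: third_part_nth fps_dilate_nth fps_X_power_mult_nth)
qed

text \<open>The series $f(q) f(\omega q) f(\omega^2 q)$ in $q^3$, with $\omega$ a primitive cube root of unity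
  and $q^3$ replaced by $q$, written in terms of the three parts of $f$ to stay over the rationals.\<close>

definition cubic_norm :: "rat fps \<Rightarrow> rat fps" where
  "cubic_norm f = third_part 0 f ^ 3 + fps_X * third_part 1 f ^ 3 + fps_X ^ 2 * third_part 2 f ^ 3 -
     3 * fps_X * third_part 0 f * third_part 1 f * third_part 2 f"

lemma cubic_norm_eqI:
  assumes "f = fps_dilate 3 a + fps_X * fps_dilate 3 b + fps_X ^ 2 * fps_dilate 3 c"
  shows "cubic_norm f = a ^ 3 + fps_X * b ^ 3 + fps_X ^ 2 * c ^ 3 - 3 * fps_X * a * b * c"
  unfolding cubic_norm_def third_part_eqI[OF assms] ..

lemma fps_dilate_3_X: "fps_dilate 3 fps_X = fps_X ^ 3"
  by (rule fps_dilate_X) simp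

text \<open>This is the norm form of the extension by a cube root of $q$. Its multiplicativity is a
  polynomial identity in the parts, once products of parts whose indices sum to 3 or more are
  carried with a factor $q$.\<close>

lemma cubic_norm_mult: "cubic_norm (f * g) = cubic_norm f * cubic_norm g"
proof -
  define a b c where abc: "a = third_part 0 f" "b = third_part 1 f" "c = third_part 2 f"
  define p q r where pqr: "p = third_part 0 g" "q = third_part 1 g" "r = third_part 2 g"
  let ?D = "fps_dilate 3" and ?X = "fps_X :: rat fps"
  have "f * g = (?D a + ?X * ?D b + ?X ^ 2 * ?D c) * (?D p + ?X * ?D q + ?X ^ 2 * ?D r)"
    unfolding abc pqr third_part_dissection[symmetric] ..
  also have "\<dots> = (?D a * ?D p + ?X ^ 3 * (?D b * ?D r + ?D c * ?D q)) +
                   ?X * (?D a * ?D q + ?D b * ?D p + ?X ^ 3 * (?D c * ?D r)) +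
                   ?X ^ 2 * (?D a * ?D r + ?D b * ?D q + ?D c * ?D p)"
    by algebra
  also have "\<dots> = ?D (a * p + ?X * (b * r + c * q)) + ?X * ?D (a * q + b * p + ?X * (c * r)) +
                   ?X ^ 2 * ?D (a * r + b * q + c * p)"
    by (simp only: fps_dilate_add fps_dilate_mult fps_dilate_3_X zero_less_numeral)
  finally have "cubic_norm (f * g) = (a * p + ?X * (b * r + c * q)) ^ 3 + ?X * (a * q + b * p + ?X * (c * r)) ^ 3 +
      ?X ^ 2 * (a * r + b * q + c * p) ^ 3 -
      3 * ?X * (a * p + ?X * (b * r + c * q)) * (a * q + b * p + ?X * (c * r)) * (a * r + b * q + c * p)"
    by (rule cubic_norm_eqI)
  also have "\<dots> = (a ^ 3 + ?X * b ^ 3 + ?X ^ 2 * c ^ 3 - 3 * ?X * a * b * c) *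
      (p ^ 3 + ?X * q ^ 3 + ?X ^ 2 * r ^ 3 - 3 * ?X * p * q * r)"
    by algebra
  finally show ?thesis
    by (simp only: cubic_norm_def abc pqr)
qed

lemma eq_upto_cubic_norm:
  assumes "eq_upto (3 * N) f g"
  shows "eq_upto N (cubic_norm f) (cubic_norm g)"
proof -
  have *: "eq_upto N (third_part r f) (third_part r g)" if "r < 3" for r
    using assms that by (auto simp: eq_upto_def third_part_nth)
  have plus: "eq_upto N (f + g) (f' + g')" "eq_upto N (f - g) (f' - g')"
    if "eq_upto N f f'" "eq_upto N g g'" for f g f' g' :: "rat fps"
    using that by (simp_all add: eq_upto_def)
  show ?thesis
    unfolding cubic_norm_def by (intro plus eq_upto_mult eq_upto_power eq_upto_refl *) auto
qed

text \<open>With $x = q^m$, the three conjugates of $1 - x$ coincide if 3 divides $m$; otherwise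
  their product is $1 - x^3$, and renaming $q^3$ to $q$ gives back $1 - q^m$.\<close>

lemma cubic_norm_one_minus_X_power:
  "cubic_norm (1 - fps_X ^ (3 * n)) = (1 - fps_X ^ n) ^ 3"
  "cubic_norm (1 - fps_X ^ (3 * n + 1)) = 1 - fps_X ^ (3 * n + 1)"
  "cubic_norm (1 - fps_X ^ (3 * n + 2)) = 1 - fps_X ^ (3 * n + 2)"
proof -
  let ?D = "fps_dilate 3" and ?X = "fps_X :: rat fps"
  have D: "?D 0 = 0" "?D 1 = 1" "?D (1 - ?X ^ n) = 1 - ?X ^ (3 * n)" "?D (- (?X ^ n)) = - (?X ^ (3 * n))"
    using fps_dilate_diff[of 3 0 "?X ^ n"] fps_dilate_diff[of 3 0 0]
    by (simp_all add: fps_dilate_diff fps_dilate_1 fps_dilate_X_power)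
  have "1 - ?X ^ (3 * n) = ?D (1 - ?X ^ n) + ?X * ?D 0 + ?X ^ 2 * ?D 0"
    unfolding D by simp
  from cubic_norm_eqI[OF this] show "cubic_norm (1 - ?X ^ (3 * n)) = (1 - ?X ^ n) ^ 3"
    by simp
  have "1 - ?X ^ (3 * n + 1) = ?D 1 + ?X * ?D (- (?X ^ n)) + ?X ^ 2 * ?D 0"
    unfolding D by (simp add: power_add)
  from cubic_norm_eqI[OF this] show "cubic_norm (1 - ?X ^ (3 * n + 1)) = 1 - ?X ^ (3 * n + 1)"
    by (simp add: power_add power_mult mult.commute[of 3 n] flip: power_minus_odd)
  have "1 - ?X ^ (3 * n + 2) = ?D 1 + ?X * ?D 0 + ?X ^ 2 * ?D (- (?X ^ n))"
    unfolding D power_add by algebra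
  from cubic_norm_eqI[OF this] have "cubic_norm (1 - ?X ^ (3 * n + 2)) =
      1 ^ 3 + ?X * 0 ^ 3 + ?X ^ 2 * (- (?X ^ n)) ^ 3 - 3 * ?X * 1 * 0 * - (?X ^ n)" .
  also have "\<dots> = 1 - (?X ^ n) ^ 3 * ?X ^ 2"
    by (simp add: mult.commute del: power_mult)
  also have "(?X ^ n) ^ 3 * ?X ^ 2 = ?X ^ (3 * n + 2)"
    by (simp only: power_add power_mult[symmetric] mult.commute[of 3 n])
  finally show "cubic_norm (1 - ?X ^ (3 * n + 2)) = 1 - ?X ^ (3 * n + 2)" .
qed

lemma cubic_norm_coprime:
  assumes "\<not> 3 dvd n"
  shows "cubic_norm (1 - fps_X ^ n) = 1 - fps_X ^ n"
proof -
  have "n mod 3 = 1 \<or> n mod 3 = 2" using assms by presburger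
  hence "n = 3 * (n div 3) + 1 \<or> n = 3 * (n div 3) + 2" by presburger
  thus ?thesis using cubic_norm_one_minus_X_power[of "n div 3"] by metis
qed

text \<open>The factors $1 - q^{3km}$ contribute $E(q^k)^3$ in total; the others are unchanged and
  give $E(q^k)/E(q^{3k})$.\<close>

lemma cubic_norm_Eta:
  assumes "\<not> 3 dvd k"
  shows "cubic_norm (Eta k) * Eta (3 * k) = Eta k ^ 4"
proof (rule fps_eq_upto_eqI)
  fix N
  have k: "k \<ge> 1" using assms by (cases k) auto
  have 1: "cubic_norm (eta_fin k (3 * N)) * eta_fin (3 * k) N = eta_fin k (3 * N) * eta_fin k N ^ 3" for N
  proof (induction N)
    case 0
    have "cubic_norm 1 = 1"
      using cubic_norm_eqI[of 1 1 0 0] fps_dilate_diff[of 3 0 0] by (simp add: fps_dilate_1)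
    thus ?case by simp
  next
    case (Suc N)
    define u v w where uvw: "u = 1 - (fps_X :: rat fps) ^ (k * (3 * N + Suc 0))"
      "v = 1 - (fps_X :: rat fps) ^ (k * (3 * N + Suc 1))"
      "w = 1 - (fps_X :: rat fps) ^ (3 * (k * Suc N))"
    have ex: "k * (3 * N + Suc 2) = 3 * (k * Suc N)" by (simp add: algebra_simps)
    have e: "eta_fin k (3 * Suc N) = eta_fin k (3 * N) * (u * v * w)"
      unfolding eta_fin_mult_Suc uvw by (simp only: prod_lessThan_3 ex)
    have "prime (3::nat)" by simp
    have nd: "\<not> 3 dvd 3 * N + Suc 0" "\<not> 3 dvd 3 * N + Suc 1"
      by presburger+
    have "cubic_norm u = u" "cubic_norm v = v" "cubic_norm w = (1 - fps_X ^ (k * Suc N)) ^ 3"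
      unfolding uvw using nd assms \<open>prime 3\<close>
      by (auto intro!: cubic_norm_coprime cubic_norm_one_minus_X_power simp only: prime_dvd_mult_iff)
    hence "cubic_norm (eta_fin k (3 * Suc N)) * eta_fin (3 * k) (Suc N) =
      (cubic_norm (eta_fin k (3 * N)) * eta_fin (3 * k) N) * (u * v * w) * (1 - fps_X ^ (k * Suc N)) ^ 3"
      unfolding e cubic_norm_mult eta_fin_Suc uvw(3) by (simp only: mult_ac)
    thus ?case
      unfolding Suc e eta_fin_Suc power_mult_distrib by (simp only: mult_ac)
  qed
  have "eq_upto N (cubic_norm (Eta k) * Eta (3 * k)) (cubic_norm (eta_fin k (3 * N)) * eta_fin (3 * k) N)"
    using k by (intro eq_upto_mult eq_upto_cubic_norm eq_upto_Eta) auto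
  also note 1
  also have "eq_upto N (eta_fin k (3 * N) * eta_fin k N ^ 3) (Eta k * Eta k ^ 3)"
    using k by (intro eq_upto_mult eq_upto_power eq_upto_sym[OF eq_upto_Eta]) auto
  also have "Eta k * Eta k ^ 3 = Eta k ^ 4"
    by (simp add: eval_nat_numeral)
  finally show "eq_upto N (cubic_norm (Eta k) * Eta (3 * k)) (Eta k ^ 4)" .
qed

text \<open>Two computations of one norm: from the 3-dissection, which has no part of index 2, and
  from the eta quotient.\<close>

lemma psi_cubic_identity:
  "(theta_A ^ 3 + fps_X * fps_dilate 3 psi_fps ^ 3) * Eta 1 ^ 4 * Eta 6 ^ 2 = Eta 2 ^ 8 * Eta 3"
proof -
  define M where "M = theta_A ^ 3 + fps_X * fps_dilate 3 psi_fps ^ 3"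
  have D0: "fps_dilate 3 0 = 0"
    using fps_dilate_diff[of 3 0 0] by simp
  have "psi_fps = fps_dilate 3 theta_A + fps_X * fps_dilate 3 (fps_dilate 3 psi_fps) + fps_X ^ 2 * fps_dilate 3 0"
    unfolding D0 mult_zero_right add_0_right by (rule psi_dissection)
  from cubic_norm_eqI[OF this] have M: "cubic_norm psi_fps = M"
    by (simp add: M_def)
  have "psi_fps * Eta 1 = Eta 2 * Eta 2"
    by (simp add: psi_fps_def fps_divide_unit mult.assoc inverse_mult_eq_1 power2_eq_square)
  hence eq: "M * cubic_norm (Eta 1) = cubic_norm (Eta 2) * cubic_norm (Eta 2)"
    by (simp flip: M cubic_norm_mult)
  have E1: "cubic_norm (Eta 1) * Eta 3 = Eta 1 ^ 4"
    using cubic_norm_Eta[of 1] by simp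
  have E2: "cubic_norm (Eta 2) * Eta 6 = Eta 2 ^ 4"
    using cubic_norm_Eta[of 2] by simp
  have "M * Eta 1 ^ 4 * Eta 6 ^ 2 = (M * cubic_norm (Eta 1)) * Eta 3 * Eta 6 ^ 2"
    by (simp only: flip: E1) (simp only: mult_ac)
  also have "\<dots> = (cubic_norm (Eta 2) * Eta 6) ^ 2 * Eta 3"
    unfolding eq by algebra
  also have "\<dots> = Eta 2 ^ 8 * Eta 3"
    unfolding E2 by (simp flip: power_mult)
  finally show ?thesis by (simp only: M_def)
qed

text \<open>Compares the terms with exponent divisible by 3 on both sides of
  $\psi(q)^2 \varphi(-q) = \varphi(-q^2)^2 \psi(q^2)$, where both sides equal $E(q^2)^3$.\<close>

lemma psi_phi_identity:
  "theta_A ^ 2 * fps_dilate 3 phi_fps - 2 * fps_X * fps_dilate 3 psi_fps ^ 2 * theta_B =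
   fps_dilate 6 phi_fps ^ 2 * fps_dilate 2 theta_A + 4 * fps_X ^ 2 * fps_dilate 2 theta_B ^ 2 * fps_dilate 6 psi_fps"
proof -
  let ?D = "fps_dilate 3" and ?X = "fps_X :: rat fps"
  define A B p f where ABpf: "A = theta_A" "B = theta_B" "p = ?D psi_fps" "f = ?D phi_fps"
  define A' B' p' f' where ABpf': "A' = fps_dilate 2 theta_A" "B' = fps_dilate 2 theta_B"
    "p' = fps_dilate 6 psi_fps" "f' = fps_dilate 6 phi_fps"
  have psi: "psi_fps = ?D A + ?X * ?D p"
    unfolding ABpf by (rule psi_dissection)
  have phi: "phi_fps = ?D f - 2 * ?X * ?D B"
    unfolding ABpf by (rule phi_dissection)
  have psi2: "fps_dilate 2 psi_fps = ?D A' + ?X ^ 2 * ?D p'"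
    by (subst psi_dissection)
       (simp add: ABpf' fps_dilate_add fps_dilate_mult fps_dilate_dilate fps_dilate_X)
  have phi2: "fps_dilate 2 phi_fps = ?D f' - 2 * ?X ^ 2 * ?D B'"
    by (subst phi_dissection)
       (simp add: ABpf' fps_dilate_diff fps_dilate_mult fps_dilate_dilate fps_dilate_X fps_dilate_numeral)
  have eq: "psi_fps ^ 2 * phi_fps = fps_dilate 2 phi_fps ^ 2 * fps_dilate 2 psi_fps"
  proof -
    have "fps_to_fls (psi_fps ^ 2 * phi_fps) = fps_to_fls (fps_dilate 2 phi_fps ^ 2 * fps_dilate 2 psi_fps)"
      by (simp add: psi_fps_def phi_fps_def fps_dilate_divide fps_dilate_power fps_dilate_Eta
            fls_times_fps_to_fls fps_to_fls_power fps_to_fls_divide_unit)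
         (simp add: field_simps eval_nat_numeral)
    thus ?thesis by simp
  qed
  have "psi_fps ^ 2 * phi_fps = (?D A + ?X * ?D p) ^ 2 * (?D f - 2 * ?X * ?D B)"
    by (simp only: flip: psi phi)
  also have "\<dots> = (?D A ^ 2 * ?D f - 2 * ?X ^ 3 * ?D p ^ 2 * ?D B) + ?X * (2 * ?D A * ?D p * ?D f - 2 * ?D A ^ 2 * ?D B) +
      ?X ^ 2 * (?D p ^ 2 * ?D f - 4 * ?D A * ?D p * ?D B)"
    by algebra
  also have "\<dots> = ?D (A ^ 2 * f - 2 * ?X * p ^ 2 * B) + ?X * ?D (2 * A * p * f - 2 * A ^ 2 * B) +
      ?X ^ 2 * ?D (p ^ 2 * f - 4 * A * p * B)"
    by (simp add: fps_dilate_diff fps_dilate_mult fps_dilate_power fps_dilate_numeral fps_dilate_3_X)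
  finally have 1: "third_part 0 (psi_fps ^ 2 * phi_fps) = A ^ 2 * f - 2 * ?X * p ^ 2 * B"
    by (rule third_part_eqI)
  have "psi_fps ^ 2 * phi_fps = (?D f' - 2 * ?X ^ 2 * ?D B') ^ 2 * (?D A' + ?X ^ 2 * ?D p')"
    unfolding eq by (simp only: flip: psi2 phi2)
  also have "\<dots> = (?D f' ^ 2 * ?D A' + 4 * (?X ^ 3) ^ 2 * ?D B' ^ 2 * ?D p') +
      ?X * (?X ^ 3 * (4 * ?D B' ^ 2 * ?D A' - 4 * ?D f' * ?D B' * ?D p')) +
      ?X ^ 2 * (?D f' ^ 2 * ?D p' - 4 * ?D f' * ?D B' * ?D A')"
    by algebra
  also have "\<dots> = ?D (f' ^ 2 * A' + 4 * ?X ^ 2 * B' ^ 2 * p') + ?X * ?D (?X * (4 * B' ^ 2 * A' - 4 * f' * B' * p')) +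
      ?X ^ 2 * ?D (f' ^ 2 * p' - 4 * f' * B' * A')"
    by (simp add: fps_dilate_diff fps_dilate_add fps_dilate_mult fps_dilate_power fps_dilate_numeral fps_dilate_3_X)
  finally have "third_part 0 (psi_fps ^ 2 * phi_fps) = f' ^ 2 * A' + 4 * ?X ^ 2 * B' ^ 2 * p'"
    by (rule third_part_eqI)
  with 1 show ?thesis
    unfolding ABpf ABpf' by simp
qed

text \<open>The norm argument again; cubing the part \<open>- (2 * theta_B)\<close> gives the
  8.\<close>

lemma phi_cubic_identity:
  "(fps_dilate 3 phi_fps ^ 3 - 8 * fps_X * theta_B ^ 3) * Eta 2 ^ 4 * Eta 3 ^ 2 = Eta 1 ^ 8 * Eta 6"
proof -
  define M where "M = fps_dilate 3 phi_fps ^ 3 - 8 * fps_X * theta_B ^ 3"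
  have D: "fps_dilate 3 0 = 0" "fps_dilate 3 (- (2 * theta_B)) = - (2 * fps_dilate 3 theta_B)"
    using fps_dilate_diff[of 3 0 0] fps_dilate_diff[of 3 0 "2 * theta_B"]
    by (simp_all add: fps_dilate_mult fps_dilate_numeral)
  have "phi_fps = fps_dilate 3 (fps_dilate 3 phi_fps) + fps_X * fps_dilate 3 (- (2 * theta_B)) + fps_X ^ 2 * fps_dilate 3 0"
    unfolding D by (subst phi_dissection) simp
  from cubic_norm_eqI[OF this] have M: "cubic_norm phi_fps = M"
    by (simp add: M_def power_mult_distrib)
  have "phi_fps * Eta 2 = Eta 1 * Eta 1"
    by (simp add: phi_fps_def fps_divide_unit mult.assoc inverse_mult_eq_1 power2_eq_square)
  hence eq: "M * cubic_norm (Eta 2) = cubic_norm (Eta 1) * cubic_norm (Eta 1)"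
    by (simp flip: M cubic_norm_mult)
  have E1: "cubic_norm (Eta 1) * Eta 3 = Eta 1 ^ 4"
    using cubic_norm_Eta[of 1] by simp
  have E2: "cubic_norm (Eta 2) * Eta 6 = Eta 2 ^ 4"
    using cubic_norm_Eta[of 2] by simp
  have "M * Eta 2 ^ 4 * Eta 3 ^ 2 = (M * cubic_norm (Eta 2)) * Eta 6 * Eta 3 ^ 2"
    by (simp only: flip: E2) (simp only: mult_ac)
  also have "\<dots> = (cubic_norm (Eta 1) * Eta 3) ^ 2 * Eta 6"
    unfolding eq by algebra
  also have "\<dots> = Eta 1 ^ 8 * Eta 6"
    unfolding E1 by (simp flip: power_mult)
  finally show ?thesis by (simp only: M_def)
qed

text \<open>Here $e_k$ stands for $E(q^k)$. The assumptions I1, I2, I3 are the theta function identities above and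
  I2' is I2 with $q$ replaced by $q^2$; nd1, nd2, nd3 discard the wrong factor each time
  a quadratic equation is solved. The eta quotients $a, b, c, d$ turn out to be
  $t + 1$, $t - 1$, $t + 3$, $t - 3$.\<close>

locale level12 =
  fixes q e1 e2 e3 e4 e6 e12 :: "'a :: field_char_0"
  assumes nz [simp]: "q \<noteq> 0" "e1 \<noteq> 0" "e2 \<noteq> 0" "e3 \<noteq> 0" "e4 \<noteq> 0" "e6 \<noteq> 0" "e12 \<noteq> 0"
  assumes I1: "(e2 * e3 ^ 2 / (e1 * e6)) ^ 2 * (e3 ^ 2 / e6) - 2 * q * (e6 ^ 2 / e3) ^ 2 * (e1 * e6 ^ 2 / (e2 * e3)) =
     (e6 ^ 2 / e12) ^ 2 * (e4 * e6 ^ 2 / (e2 * e12)) + 4 * q ^ 2 * (e2 * e12 ^ 2 / (e4 * e6)) ^ 2 * (e12 ^ 2 / e6)"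
  assumes I2: "((e2 * e3 ^ 2 / (e1 * e6)) ^ 3 + q * (e6 ^ 2 / e3) ^ 3) * e1 ^ 4 * e6 ^ 2 = e2 ^ 8 * e3"
  assumes I2': "((e4 * e6 ^ 2 / (e2 * e12)) ^ 3 + q ^ 2 * (e12 ^ 2 / e6) ^ 3) * e2 ^ 4 * e12 ^ 2 = e4 ^ 8 * e6"
  assumes I3: "((e3 ^ 2 / e6) ^ 3 - 8 * q * (e1 * e6 ^ 2 / (e2 * e3)) ^ 3) * e2 ^ 4 * e3 ^ 2 = e1 ^ 8 * e6"
  assumes nd1: "e3 ^ 3 * e4 + 2 * q * e1 * e12 ^ 3 \<noteq> 0"
  assumes nd2: "e2 * e3 ^ 3 * e4 ^ 4 * e6 ^ 2 * e12 ^ 2 + e1 * e4 ^ 2 * e6 ^ 9 + q * e2 ^ 3 * e3 ^ 3 * e12 ^ 6 \<noteq> 0"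
  assumes nd3: "e1 ^ 3 * e4 * e6 ^ 2 * e12 + e3 * e4 ^ 4 * e6 ^ 2 - 3 * q * e2 ^ 2 * e3 * e12 ^ 4 \<noteq> 0"
begin

definition "t = e4 ^ 4 * e6 ^ 2 / (q * e2 ^ 2 * e12 ^ 4)"
definition "a = e3 ^ 3 * e4 / (q * e1 * e12 ^ 3)"
definition "b = e1 * e4 ^ 2 * e6 ^ 9 / (q * e2 ^ 3 * e3 ^ 3 * e12 ^ 6)"
definition "c = e2 ^ 7 * e3 / (q * e1 ^ 3 * e4 ^ 2 * e6 * e12 ^ 2)"
definition "d = e1 ^ 3 * e4 * e6 ^ 2 / (q * e2 ^ 2 * e3 * e12 ^ 3)"

lemmas defs = t_def a_def b_def c_def d_def

lemma nonzero [simp]: "t \<noteq> 0" "a \<noteq> 0" "b \<noteq> 0" "c \<noteq> 0" "d \<noteq> 0"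
  by (simp_all add: defs)

text \<open>In terms of $a$ and $b$, I1 reads $a^2 - 2b = ab + 4$, that is $(a+2)(a-b-2) = 0$;
  \<open>nd1\<close> excludes the first factor.\<close>

lemma a_eq: "a = b + 2"
proof -
  have "a ^ 2 - 2 * b = a * b + 4"
    using I1 unfolding a_def b_def by (simp add: divide_simps) algebra
  hence "(a + 2) * (a - b - 2) = 0" by algebra
  moreover have "a + 2 \<noteq> 0"
    using nd1 by (simp add: a_def divide_simps mult_ac)
  ultimately have "a - b - 2 = 0" by simp
  thus ?thesis by (simp add: algebra_simps)
qed

text \<open>I2' reads $t^2 = ab + 1$, which is $(b+1)^2$ by \<open>a_eq\<close>; \<open>nd2\<close>
  fixes the sign.\<close>

lemma t_eq_b: "t = b + 1"
proof -
  have "t ^ 2 = a * b + 1"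
    using I2' unfolding a_def b_def t_def by (simp add: divide_simps) algebra
  hence "(t + b + 1) * (t - b - 1) = 0" unfolding a_eq by algebra
  moreover have "(t + b + 1) * (q * e2 ^ 3 * e3 ^ 3 * e12 ^ 6) =
      e2 * e3 ^ 3 * e4 ^ 4 * e6 ^ 2 * e12 ^ 2 + e1 * e4 ^ 2 * e6 ^ 9 + q * e2 ^ 3 * e3 ^ 3 * e12 ^ 6"
    unfolding t_def b_def by (simp add: divide_simps) algebra
  hence "t + b + 1 \<noteq> 0" using nd2 by force
  ultimately have "t - b - 1 = 0" by simp
  thus ?thesis by (simp add: algebra_simps)
qed

lemma b_t: "b = t - 1" and a_t: "a = t + 1"
  using t_eq_b a_eq by simp_all

text \<open>A Hauptmodul of level 6 for which $s-1$ and $s-9$ are eta quotients as well. It links I2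
  and I3, which are of level 6, to $c$ and $d$.\<close>

definition "s = e2 ^ 8 * e3 ^ 4 / (q * e1 ^ 4 * e6 ^ 8)"

lemma s_eq1: "s = 1 + a ^ 2 / b"
  using I2 unfolding a_def b_def s_def by (simp add: divide_simps) algebra

lemma s_eq9: "s = 9 + d ^ 2 / b"
proof -
  have "e2 ^ 3 * e3 ^ 9 / (q * e1 ^ 3 * e6 ^ 9) = 8 + d ^ 2 / b"
    using I3 unfolding d_def b_def by (simp add: divide_simps) algebra
  moreover have "e2 ^ 3 * e3 ^ 9 / (q * e1 ^ 3 * e6 ^ 9) = a ^ 2 / b"
    unfolding a_def b_def by (simp add: divide_simps) algebra
  ultimately show ?thesis by (simp add: s_eq1)
qed

text \<open>As eta quotients $c = sb/t$, and \<open>s_eq1\<close> gives $sb = b + a^2 =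
  t(t+3)$.\<close>

lemma c_t: "c = t + 3"
proof -
  have "c = s * b / t"
    unfolding c_def s_def b_def t_def by (simp add: divide_simps) algebra
  also have "s * b = b + a ^ 2"
    by (simp add: s_eq1 field_simps)
  also have "\<dots> = t * (t + 3)"
    unfolding b_t a_t by algebra
  finally show ?thesis by simp
qed

text \<open>The two expressions for $s$ give $d^2 = a^2 - 8b = (t-3)^2$; \<open>nd3\<close> fixes
  the sign.\<close>

lemma d_t: "d = t - 3"
proof -
  have "a ^ 2 / b = 8 + d ^ 2 / b"
    using s_eq1 s_eq9 by simp
  hence "a ^ 2 = 8 * b + d ^ 2"
    by (simp add: field_simps)
  hence "(d + t - 3) * (d - t + 3) = 0"
    unfolding a_t b_t by algebra
  moreover have "(d + t - 3) * (q * e2 ^ 2 * e3 * e12 ^ 4) =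
      e1 ^ 3 * e4 * e6 ^ 2 * e12 + e3 * e4 ^ 4 * e6 ^ 2 - 3 * q * e2 ^ 2 * e3 * e12 ^ 4"
    unfolding t_def d_def by (simp add: divide_simps) algebra
  hence "d + t - 3 \<noteq> 0" using nd3 by force
  ultimately have "d - t + 3 = 0" by simp
  thus ?thesis by (simp add: algebra_simps)
qed

text \<open>All four are rational identities in $t$. The left side of the last is $t^4 (t+3) /
  ((t-1)^2 (t+1)^3)$; its part even in $t$, namely $3Y^2 - 2Y^3$, is the source of
  \<open>Lambda 2\<close>.\<close>

lemma K_Y_relations:
  defines "K \<equiv> e2 * e3 ^ 3 * e4 ^ 2 * e12 ^ 2 / (e1 * e6 ^ 7)"
    and "Y \<equiv> e4 ^ 5 * e12 / (e2 * e6 ^ 5)"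
  shows "K ^ 2 = 2 * Y * K - Y"
    and "e2 ^ 5 * e6 / (e1 * e3 ^ 5) = (2 * Y - K) * (3 - 4 * Y + 2 * K)"
    and "K = Y + q * (e2 * e4 * e12 ^ 5 / e6 ^ 7)"
    and "(e2 * e4 * e12 / e6 ^ 3) ^ 5 * (e4 * e6 ^ 2 / (e1 * e3 * e12)) ^ 2 = 3 * Y ^ 2 - 2 * Y ^ 3 + 2 * Y ^ 2 * (K - Y)"
proof -
  have K: "K = t / b"
    unfolding K_def t_def b_def by (simp add: divide_simps) algebra
  have Y: "Y = t ^ 2 / (a * b)"
    unfolding Y_def defs by (simp add: divide_simps) algebra
  have xi: "e2 ^ 5 * e6 / (e1 * e3 ^ 5) = s * b / a ^ 2"
    unfolding s_def defs by (simp add: divide_simps) algebra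
  have H: "q * (e2 * e4 * e12 ^ 5 / e6 ^ 7) = t / (a * b)"
    unfolding defs by (simp add: divide_simps) algebra
  have L: "(e2 * e4 * e12 / e6 ^ 3) ^ 5 * (e4 * e6 ^ 2 / (e1 * e3 * e12)) ^ 2 = t ^ 4 * c * b / (a * b) ^ 3"
    unfolding defs by (simp add: divide_simps) algebra
  have "a \<noteq> 0" "b \<noteq> 0" by simp_all
  hence nz': "t + 1 \<noteq> 0" "t - 1 \<noteq> 0" unfolding a_t b_t .
  show "K ^ 2 = 2 * Y * K - Y"
    unfolding K Y a_t b_t using nz' by (simp add: divide_simps) algebra
  have sb: "s * b = t * (t + 3)"
    unfolding s_eq1 a_t b_t using nz' by (simp add: divide_simps) algebra
  have "2 * Y - K = t / a" "3 - 4 * Y + 2 * K = (t + 3) / a"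
    unfolding K Y a_t b_t using nz' by (simp add: divide_simps, algebra)+
  thus "e2 ^ 5 * e6 / (e1 * e3 ^ 5) = (2 * Y - K) * (3 - 4 * Y + 2 * K)"
    unfolding xi sb by (simp add: power2_eq_square)
  show "K = Y + q * (e2 * e4 * e12 ^ 5 / e6 ^ 7)"
    unfolding H K Y a_t b_t using nz' by (simp add: divide_simps) algebra
  show "(e2 * e4 * e12 / e6 ^ 3) ^ 5 * (e4 * e6 ^ 2 / (e1 * e3 * e12)) ^ 2 = 3 * Y ^ 2 - 2 * Y ^ 3 + 2 * Y ^ 2 * (K - Y)"
    unfolding L K Y a_t b_t c_t using nz' by (simp add: divide_simps) algebra
qed

text \<open>Input for the 2-dissection of the generating function. The brackets are one function at
  $q$ and at $q^2$: $1 + 6/(s-9)$ and $1 + 6/(t^2-9)$. The second identity splits $(t-1)/(t-3)$ over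
  the denominator $t^2 - 9$ into parts even and odd in $t$.\<close>

lemma P_identities:
  defines "P \<equiv> e4 * e6 ^ 2 / (e1 * e3 * e12)"
  shows "P ^ 4 + q * (e2 ^ 6 * e12 ^ 2 / (e1 ^ 4 * e4 ^ 2 * e6 ^ 2)) ^ 2 =
           e1 * e2 * e6 / e3 ^ 3 * (1 + 6 * q * (e2 * e6 ^ 5 / (e1 ^ 5 * e3)))"
    and "P ^ 2 = e2 * e4 * e12 / e6 ^ 3 * (1 + 6 * q ^ 2 * (e4 * e12 ^ 5 / (e2 ^ 5 * e6))) +
           2 * q * (e2 * e4 * e12 / e6 ^ 3 * (e4 ^ 5 * e6 * e12 / e2 ^ 7))"
proof -
  define D where "D = e1 * e2 * e6 / e3 ^ 3"
  define D2 where "D2 = e2 * e4 * e12 / e6 ^ 3"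
  have 1: "P ^ 4 = D * (t * b / d ^ 2)"
    unfolding P_def D_def defs by (simp add: divide_simps) algebra
  have 2: "q * (e2 ^ 6 * e12 ^ 2 / (e1 ^ 4 * e4 ^ 2 * e6 ^ 2)) ^ 2 = D * (c / d ^ 2)"
    unfolding D_def defs by (simp add: divide_simps) algebra
  have 3: "6 * q * (e2 * e6 ^ 5 / (e1 ^ 5 * e3)) = 6 * b / d ^ 2"
    unfolding defs by (simp add: divide_simps) algebra
  have 4: "P ^ 2 = D2 * (b / d)"
    unfolding P_def D2_def defs by (simp add: divide_simps) algebra
  have 5: "6 * q ^ 2 * (e4 * e12 ^ 5 / (e2 ^ 5 * e6)) = 6 / (c * d)"
    unfolding defs by (simp add: divide_simps) algebra
  have 6: "2 * q * (D2 * (e4 ^ 5 * e6 * e12 / e2 ^ 7)) = D2 * (2 * t / (c * d))"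
    unfolding D2_def defs by (simp add: divide_simps) algebra
  have "c \<noteq> 0" "d \<noteq> 0" by simp_all
  hence nz': "t + 3 \<noteq> 0" "t - 3 \<noteq> 0" unfolding c_t d_t .
  have "t * b / d ^ 2 + c / d ^ 2 = 1 + 6 * b / d ^ 2"
    unfolding b_t c_t d_t using nz' by (simp add: divide_simps) algebra
  thus "P ^ 4 + q * (e2 ^ 6 * e12 ^ 2 / (e1 ^ 4 * e4 ^ 2 * e6 ^ 2)) ^ 2 =
           e1 * e2 * e6 / e3 ^ 3 * (1 + 6 * q * (e2 * e6 ^ 5 / (e1 ^ 5 * e3)))"
    unfolding 1 2 3 D_def[symmetric] by (simp only: flip: distrib_left)
  have "b / d = (1 + 6 / (c * d)) + 2 * t / (c * d)"
    unfolding b_t c_t d_t using nz' by (simp add: divide_simps) algebra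
  thus "P ^ 2 = e2 * e4 * e12 / e6 ^ 3 * (1 + 6 * q ^ 2 * (e4 * e12 ^ 5 / (e2 ^ 5 * e6))) +
           2 * q * (e2 * e4 * e12 / e6 ^ 3 * (e4 ^ 5 * e6 * e12 / e2 ^ 7))"
    unfolding 4 5 D2_def[symmetric] 6 by (simp only: flip: distrib_left)
qed

end

section \<open>The two-dissections and the main result\<close>

abbreviation eta_fls :: "nat \<Rightarrow> rat fls" where "eta_fls k \<equiv> fps_to_fls (Eta k)"

lemmas fps_to_fls_hom = fls_times_fps_to_fls fps_to_fls_power fps_to_fls_divide_unit

lemmas fps_dilate_hom = fps_dilate_add fps_dilate_diff fps_dilate_mult fps_dilate_power fps_dilate_divide
  fps_dilate_numeral fps_dilate_1 fps_dilate_X fps_dilate_Eta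

text \<open>Laurent series are the field because $t$ has a pole at $q = 0$. The series in
  \<open>nd1\<close>, \<open>nd2\<close>, \<open>nd3\<close> have constant terms 1, 2, 2.\<close>

interpretation eta: level12 "fls_X :: rat fls" "eta_fls 1" "eta_fls 2" "eta_fls 3" "eta_fls 4" "eta_fls 6" "eta_fls 12"
proof
  have nz: "fps_to_fls f \<noteq> 0" if "fps_nth f 0 \<noteq> 0" for f :: "rat fps"
    using that by auto
  show "(eta_fls 2 * eta_fls 3 ^ 2 / (eta_fls 1 * eta_fls 6)) ^ 2 * (eta_fls 3 ^ 2 / eta_fls 6) -
      2 * fls_X * (eta_fls 6 ^ 2 / eta_fls 3) ^ 2 * (eta_fls 1 * eta_fls 6 ^ 2 / (eta_fls 2 * eta_fls 3)) =
      (eta_fls 6 ^ 2 / eta_fls 12) ^ 2 * (eta_fls 4 * eta_fls 6 ^ 2 / (eta_fls 2 * eta_fls 12)) +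
      4 * fls_X ^ 2 * (eta_fls 2 * eta_fls 12 ^ 2 / (eta_fls 4 * eta_fls 6)) ^ 2 * (eta_fls 12 ^ 2 / eta_fls 6)"
    using arg_cong[OF psi_phi_identity, of fps_to_fls]
    by (simp add: psi_fps_def phi_fps_def theta_A_def theta_B_def fps_dilate_hom fps_to_fls_hom)
  show "((eta_fls 2 * eta_fls 3 ^ 2 / (eta_fls 1 * eta_fls 6)) ^ 3 + fls_X * (eta_fls 6 ^ 2 / eta_fls 3) ^ 3) *
      eta_fls 1 ^ 4 * eta_fls 6 ^ 2 = eta_fls 2 ^ 8 * eta_fls 3"
    using arg_cong[OF psi_cubic_identity, of fps_to_fls]
    by (simp add: psi_fps_def theta_A_def fps_dilate_hom fps_to_fls_hom)
  show "((eta_fls 4 * eta_fls 6 ^ 2 / (eta_fls 2 * eta_fls 12)) ^ 3 + fls_X ^ 2 * (eta_fls 12 ^ 2 / eta_fls 6) ^ 3) *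
      eta_fls 2 ^ 4 * eta_fls 12 ^ 2 = eta_fls 4 ^ 8 * eta_fls 6"
    using arg_cong[OF psi_cubic_identity, of "\<lambda>f. fps_to_fls (fps_dilate 2 f)"]
    by (simp add: psi_fps_def theta_A_def fps_dilate_hom fps_to_fls_hom)
  show "((eta_fls 3 ^ 2 / eta_fls 6) ^ 3 - 8 * fls_X * (eta_fls 1 * eta_fls 6 ^ 2 / (eta_fls 2 * eta_fls 3)) ^ 3) *
      eta_fls 2 ^ 4 * eta_fls 3 ^ 2 = eta_fls 1 ^ 8 * eta_fls 6"
    using arg_cong[OF phi_cubic_identity, of fps_to_fls]
    by (simp add: phi_fps_def theta_B_def fps_dilate_hom fps_to_fls_hom)
  show "eta_fls 3 ^ 3 * eta_fls 4 + 2 * fls_X * eta_fls 1 * eta_fls 12 ^ 3 \<noteq> 0"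
    using nz[of "Eta 3 ^ 3 * Eta 4 + 2 * fps_X * Eta 1 * Eta 12 ^ 3"] by (simp add: fps_to_fls_hom)
  show "eta_fls 2 * eta_fls 3 ^ 3 * eta_fls 4 ^ 4 * eta_fls 6 ^ 2 * eta_fls 12 ^ 2 +
      eta_fls 1 * eta_fls 4 ^ 2 * eta_fls 6 ^ 9 + fls_X * eta_fls 2 ^ 3 * eta_fls 3 ^ 3 * eta_fls 12 ^ 6 \<noteq> 0"
    using nz[of "Eta 2 * Eta 3 ^ 3 * Eta 4 ^ 4 * Eta 6 ^ 2 * Eta 12 ^ 2 + Eta 1 * Eta 4 ^ 2 * Eta 6 ^ 9 +
      fps_X * Eta 2 ^ 3 * Eta 3 ^ 3 * Eta 12 ^ 6"] by (simp add: fps_to_fls_hom fps_nth_power_0)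
  show "eta_fls 1 ^ 3 * eta_fls 4 * eta_fls 6 ^ 2 * eta_fls 12 + eta_fls 3 * eta_fls 4 ^ 4 * eta_fls 6 ^ 2 -
      3 * fls_X * eta_fls 2 ^ 2 * eta_fls 3 * eta_fls 12 ^ 4 \<noteq> 0"
    using nz[of "Eta 1 ^ 3 * Eta 4 * Eta 6 ^ 2 * Eta 12 + Eta 3 * Eta 4 ^ 4 * Eta 6 ^ 2 -
      3 * fps_X * Eta 2 ^ 2 * Eta 3 * Eta 12 ^ 4"] by (simp add: fps_to_fls_hom fps_nth_power_0)
qed simp_all

definition K_fps :: "rat fps" where
  "K_fps = Eta 2 * Eta 3 ^ 3 * Eta 4 ^ 2 * Eta 12 ^ 2 / (Eta 1 * Eta 6 ^ 7)"

definition Y_fps :: "rat fps" where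
  "Y_fps = fps_dilate 2 xi_fps"

text \<open>The fifth root of \<open>gamma_fps\<close>.\<close>

definition delta_fps :: "rat fps" where
  "delta_fps = Eta 1 * Eta 2 * Eta 6 / Eta 3 ^ 3"

text \<open>The odd part $K - Y$ of $K$ is $q$ times this series at $q^2$.\<close>

definition K_odd :: "rat fps" where
  "K_odd = Eta 1 * Eta 2 * Eta 6 ^ 5 / Eta 3 ^ 7"

lemma gamma_nth_0: "fps_nth gamma_fps 0 = 1"
  by (simp add: gamma_fps_def fps_divide_unit fps_nth_power_0)

lemma fps_to_fls_Y: "fps_to_fls Y_fps = eta_fls 4 ^ 5 * eta_fls 12 / (eta_fls 2 * eta_fls 6 ^ 5)"
  by (simp add: Y_fps_def xi_fps_def fps_dilate_hom fps_to_fls_hom)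

lemma fps_to_fls_K: "fps_to_fls K_fps = eta_fls 2 * eta_fls 3 ^ 3 * eta_fls 4 ^ 2 * eta_fls 12 ^ 2 / (eta_fls 1 * eta_fls 6 ^ 7)"
  by (simp add: K_fps_def fps_to_fls_hom)

lemma fps_to_fls_PDO: "fps_to_fls PDO_gf = eta_fls 4 * eta_fls 6 ^ 2 / (eta_fls 1 * eta_fls 3 * eta_fls 12)"
  by (simp add: PDO_gf_def fps_to_fls_hom)

lemma K_square: "K_fps ^ 2 = 2 * Y_fps * K_fps - Y_fps"
proof -
  have "fps_to_fls (K_fps ^ 2) = fps_to_fls (2 * Y_fps * K_fps - Y_fps)"
    using eta.K_Y_relations(1) by (simp only: fps_to_fls_hom fps_to_fls_minus fps_to_fls_numeral fps_to_fls_Y fps_to_fls_K)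
  thus ?thesis by (simp only: fps_to_fls_eq_iff)
qed

lemma xi_eq: "xi_fps = (2 * Y_fps - K_fps) * (3 - 4 * Y_fps + 2 * K_fps)"
proof -
  have "fps_to_fls xi_fps = eta_fls 2 ^ 5 * eta_fls 6 / (eta_fls 1 * eta_fls 3 ^ 5)"
    by (simp add: xi_fps_def fps_to_fls_hom)
  hence "fps_to_fls xi_fps = fps_to_fls ((2 * Y_fps - K_fps) * (3 - 4 * Y_fps + 2 * K_fps))"
    using eta.K_Y_relations(2)
    by (simp only: fps_to_fls_hom fps_to_fls_minus fps_to_fls_plus fps_to_fls_numeral fps_to_fls_Y fps_to_fls_K)
  thus ?thesis by (simp only: fps_to_fls_eq_iff)
qed

lemma K_dissection: "K_fps = Y_fps + fps_X * fps_dilate 2 K_odd"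
proof -
  have "fps_to_fls (fps_dilate 2 K_odd) = eta_fls 2 * eta_fls 4 * eta_fls 12 ^ 5 / eta_fls 6 ^ 7"
    by (simp add: K_odd_def fps_dilate_hom fps_to_fls_hom)
  hence "fps_to_fls K_fps = fps_to_fls (Y_fps + fps_X * fps_dilate 2 K_odd)"
    using eta.K_Y_relations(3)
    by (simp only: fps_to_fls_hom fps_to_fls_plus fps_X_to_fls fps_to_fls_Y fps_to_fls_K)
  thus ?thesis by (simp only: fps_to_fls_eq_iff)
qed

lemma gamma_PDO_square:
  "fps_dilate 2 gamma_fps * PDO_gf ^ 2 = 3 * Y_fps ^ 2 - 2 * Y_fps ^ 3 + 2 * Y_fps ^ 2 * (K_fps - Y_fps)"
proof -
  have "fps_to_fls (fps_dilate 2 gamma_fps) = (eta_fls 2 * eta_fls 4 * eta_fls 12 / eta_fls 6 ^ 3) ^ 5"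
    by (simp add: gamma_fps_def fps_dilate_hom fps_to_fls_hom power_divide power_mult_distrib flip: power_mult)
  hence "fps_to_fls (fps_dilate 2 gamma_fps * PDO_gf ^ 2) =
           fps_to_fls (3 * Y_fps ^ 2 - 2 * Y_fps ^ 3 + 2 * Y_fps ^ 2 * (K_fps - Y_fps))"
    using eta.K_Y_relations(4)
    by (simp only: fps_to_fls_hom fps_to_fls_plus fps_to_fls_minus fps_to_fls_numeral fps_to_fls_Y fps_to_fls_K fps_to_fls_PDO)
  thus ?thesis by (simp only: fps_to_fls_eq_iff)
qed

text \<open>Exponents already cancel at the level of fifth roots: \<open>K_fps\<close> is the square
  of \<open>delta_fps\<close> at $q^2$, divided by \<open>delta_fps\<close>.\<close>

lemma kappa_eq: "kappa_fps = K_fps ^ 5"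
proof -
  have "fps_to_fls kappa_fps = fps_to_fls (K_fps ^ 5)"
    unfolding kappa_fps_def fps_to_fls_power fps_to_fls_K
    by (simp add: gamma_fps_def fps_dilate_hom fps_to_fls_hom divide_simps) algebra
  thus ?thesis by (simp only: fps_to_fls_eq_iff)
qed

lemma kappa_gamma: "kappa_fps * gamma_fps = fps_dilate 2 gamma_fps ^ 2"
  using inverse_mult_eq_1[of gamma_fps] gamma_nth_0
  by (simp add: kappa_fps_def fps_divide_unit mult.assoc)

text \<open>The square of the right-hand side is computed from two identities for the square and the fourth
  power of the generating function, so no level 24 identity is needed.\<close>

lemma PDO_dissection:
  "PDO_gf = fps_dilate 2 (PDO_gf ^ 2) + fps_X * fps_dilate 2 (Eta 2 ^ 6 * Eta 12 ^ 2 / (Eta 1 ^ 4 * Eta 4 ^ 2 * Eta 6 ^ 2))"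
proof -
  let ?X = "fps_X :: rat fps" and ?P = PDO_gf
  define B where "B = Eta 2 ^ 6 * Eta 12 ^ 2 / (Eta 1 ^ 4 * Eta 4 ^ 2 * Eta 6 ^ 2)"
  define h where "h = delta_fps * (Eta 2 ^ 5 * Eta 3 * Eta 6 / Eta 1 ^ 7)"
  define g where "g = delta_fps * (1 + 6 * ?X * (Eta 2 * Eta 6 ^ 5 / (Eta 1 ^ 5 * Eta 3)))"
  have "fps_to_fls (?P ^ 4 + ?X * B ^ 2) = fps_to_fls g"
    using eta.P_identities(1) by (simp add: B_def g_def delta_fps_def fps_to_fls_hom fps_to_fls_PDO)
  hence 1: "?P ^ 4 + ?X * B ^ 2 = g" by (simp only: fps_to_fls_eq_iff)
  \<comment> \<open>The same \<open>g\<close> as in the fourth-power identity, now at $q^2$; this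
    match lets the square of the candidate close up.\<close>
  have "fps_to_fls (?P ^ 2) = fps_to_fls (fps_dilate 2 g + 2 * ?X * fps_dilate 2 h)"
    using eta.P_identities(2)
    by (simp add: h_def g_def delta_fps_def fps_to_fls_hom fps_dilate_hom fps_to_fls_PDO)
  hence 2: "?P ^ 2 = fps_dilate 2 g + 2 * ?X * fps_dilate 2 h" by (simp only: fps_to_fls_eq_iff)
  have "fps_to_fls (?P ^ 2 * B) = fps_to_fls h"
    by (simp add: h_def B_def delta_fps_def fps_to_fls_hom fps_to_fls_PDO divide_simps) algebra
  hence 3: "?P ^ 2 * B = h" by (simp only: fps_to_fls_eq_iff)
  define Q where "Q = fps_dilate 2 (?P ^ 2) + ?X * fps_dilate 2 B"
  have "Q ^ 2 = (fps_dilate 2 (?P ^ 2) ^ 2 + ?X ^ 2 * fps_dilate 2 B ^ 2) +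
                  2 * ?X * (fps_dilate 2 (?P ^ 2) * fps_dilate 2 B)"
    unfolding Q_def by algebra
  also have "\<dots> = fps_dilate 2 (?P ^ 4 + ?X * B ^ 2) + 2 * ?X * fps_dilate 2 (?P ^ 2 * B)"
    by (simp add: fps_dilate_hom flip: power_mult)
  also have "\<dots> = ?P ^ 2" unfolding 1 3 by (rule 2[symmetric])
  finally have "(Q - ?P) * (Q + ?P) = 0" by algebra
  \<comment> \<open>Both series have constant term 1, which decides between the two square
    roots.\<close>
  moreover have "fps_nth (Q + ?P) 0 \<noteq> 0"
    by (simp add: Q_def PDO_gf_def fps_divide_unit fps_nth_power_0)
  hence "Q + ?P \<noteq> 0" by force
  ultimately show ?thesis by (simp add: Q_def B_def)
qed

section \<open>The operator U and the recurrence for Lambda\<close>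

lemma fps_U_dissection: "fps_U (fps_dilate 2 f + fps_X * fps_dilate 2 g) = f"
proof (rule fps_ext)
  fix n :: nat
  have "n > 0 \<Longrightarrow> odd (2 * n - 1)" by presburger
  thus "fps_nth (fps_U (fps_dilate 2 f + fps_X * fps_dilate 2 g)) n = fps_nth f n"
    by (simp add: fps_U_def fps_dilate_nth)
qed

lemma fps_dissection_2: "f = fps_dilate 2 (fps_U f) + fps_X * fps_dilate 2 (Abs_fps (\<lambda>n. fps_nth f (2 * n + 1)))"
  by (rule fps_ext) (auto simp: fps_U_def fps_dilate_nth elim!: oddE)

lemma fps_U_dilate_mult: "fps_U (fps_dilate 2 f * g) = f * fps_U g"
proof -
  have "fps_dilate 2 f * g = fps_dilate 2 (f * fps_U g) +
      fps_X * fps_dilate 2 (f * Abs_fps (\<lambda>n. fps_nth g (2 * n + 1)))"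
    by (subst (1) fps_dissection_2[of g]) (simp add: fps_dilate_mult algebra_simps)
  thus ?thesis by (simp only: fps_U_dissection)
qed

lemma fps_U_add: "fps_U (f + g) = fps_U f + fps_U g"
  by (rule fps_ext) (simp add: fps_U_def)

lemma fps_U_sum: "fps_U (sum f A) = (\<Sum>x\<in>A. fps_U (f x))"
  by (rule fps_ext) (simp add: fps_U_def fps_sum_nth)

lemma fps_U_const_mult: "fps_U (fps_const c * f) = fps_const c * fps_U f"
  by (rule fps_ext) (simp add: fps_U_def)

lemma fps_U_dilate: "fps_U (fps_dilate 2 f) = f"
  by (rule fps_ext) (simp add: fps_U_def fps_dilate_nth)

lemma fps_U_K: "fps_U K_fps = xi_fps"
  unfolding K_dissection Y_fps_def by (rule fps_U_dissection)

lemma fps_U_PDO: "fps_U PDO_gf = PDO_gf ^ 2"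
  by (subst PDO_dissection) (rule fps_U_dissection)

text \<open>The first \<open>fps_U\<close> squares the generating function; the second removes
  $2Y^2(K-Y)$, which is odd in $q$.\<close>

lemma Lambda_2: "Lambda 2 = 3 * xi_fps ^ 2 - 2 * xi_fps ^ 3"
proof -
  have "Abs_fps (\<lambda>n. PDO (4 * n)) = fps_U (fps_U PDO_gf)"
    by (rule fps_ext) (simp add: fps_U_def PDO_def)
  hence "Lambda 2 = gamma_fps * fps_U (PDO_gf ^ 2)"
    by (simp add: Lambda_def fps_U_PDO)
  also have "\<dots> = fps_U (fps_dilate 2 gamma_fps * PDO_gf ^ 2)"
    by (rule fps_U_dilate_mult[symmetric])
  also have "fps_dilate 2 gamma_fps * PDO_gf ^ 2 =
      fps_dilate 2 (3 * xi_fps ^ 2 - 2 * xi_fps ^ 3) + fps_X * fps_dilate 2 (2 * xi_fps ^ 2 * K_odd)"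
    unfolding gamma_PDO_square K_dissection
    by (simp add: Y_fps_def fps_dilate_hom)
  also have "fps_U \<dots> = 3 * xi_fps ^ 2 - 2 * xi_fps ^ 3"
    by (rule fps_U_dissection)
  finally show ?thesis .
qed

text \<open>A power of \<gamma> moved under \<open>fps_U\<close> is dilated. Since \<gamma>$(q^2)^2$
  = \<kappa>\<gamma>, the exponent $2^{k-2}$ becomes $2^{k-3}$ on both \<kappa> and \<gamma>, and
  that power of \<gamma> is the normalisation of \<open>Lambda (k - 1)\<close>.\<close>

lemma Lambda_step:
  assumes "k \<ge> 3"
  shows "Lambda k = fps_U (kappa_fps ^ (2 ^ (k - 3)) * Lambda (k - 1))"
proof -
  define j where "j = k - 3"
  have k: "k = j + 3" using assms by (simp add: j_def)
  define G where "G = Abs_fps (\<lambda>n. PDO (2 ^ (j + 2) * n))"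
  have "Abs_fps (\<lambda>n. PDO (2 ^ (j + 3) * n)) = fps_U G"
    by (rule fps_ext) (simp add: fps_U_def G_def power_add mult_ac)
  hence "Lambda k = gamma_fps ^ (2 ^ (j + 1)) * fps_U G"
    by (simp add: Lambda_def k)
  also have "\<dots> = fps_U (fps_dilate 2 (gamma_fps ^ (2 ^ (j + 1))) * G)"
    by (rule fps_U_dilate_mult[symmetric])
  also have "fps_dilate 2 (gamma_fps ^ (2 ^ (j + 1))) = (fps_dilate 2 gamma_fps ^ 2) ^ (2 ^ j)"
    by (simp add: fps_dilate_power flip: power_mult)
  also have "\<dots> = kappa_fps ^ (2 ^ j) * gamma_fps ^ (2 ^ j)"
    by (simp only: power_mult_distrib flip: kappa_gamma)
  finally show ?thesis
    by (simp add: k Lambda_def G_def mult.assoc)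
qed

section \<open>Integer polynomials at a power series\<close>

lemma int_poly_at_pCons: "int_poly_at (pCons a p) f = of_int a + f * int_poly_at p f"
  by (simp add: int_poly_at_def map_poly_pCons fps_of_int)

lemma int_poly_at_0 [simp]: "int_poly_at 0 f = 0"
  by (simp add: int_poly_at_def)

lemma int_poly_at_add: "int_poly_at (p + q) f = int_poly_at p f + int_poly_at q f"
proof -
  have "map_poly (\<lambda>a. fps_const (of_int a) :: rat fps) (p + q) =
          map_poly (\<lambda>a. fps_const (of_int a)) p + map_poly (\<lambda>a. fps_const (of_int a)) q"
    by (rule poly_eqI) (simp add: coeff_map_poly)
  thus ?thesis by (simp add: int_poly_at_def)
qed

lemma int_poly_at_smult: "int_poly_at (smult c p) f = of_int c * int_poly_at p f"
  by (induction p) (simp_all add: int_poly_at_pCons algebra_simps)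

lemma int_poly_at_mult: "int_poly_at (p * q) f = int_poly_at p f * int_poly_at q f"
  by (induction p) (simp_all add: int_poly_at_pCons int_poly_at_add int_poly_at_smult algebra_simps)

lemma int_poly_at_X: "int_poly_at [:0, 1:] f = f"
  by (simp add: int_poly_at_pCons)

lemma int_poly_at_const: "int_poly_at [:c:] f = of_int c"
  by (simp add: int_poly_at_pCons)

lemma int_poly_at_altdef:
  "int_poly_at p f = (\<Sum>l\<le>degree p. fps_const (of_int (coeff p l)) * f ^ l)"
  unfolding int_poly_at_def poly_altdef by (simp add: degree_map_poly coeff_map_poly)

lemma int_poly_at_dilate: "int_poly_at p (fps_dilate 2 f) = fps_dilate 2 (int_poly_at p f)"
proof (induction p)
  case 0
  show ?case using fps_dilate_diff[of 2 0 0] by simp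
next
  case (pCons a p)
  have "fps_dilate 2 (of_int a) = of_int a"
    using fps_dilate_const[of 2 "of_int a"] by (simp add: fps_of_int)
  thus ?case using pCons by (simp add: int_poly_at_pCons fps_dilate_add fps_dilate_mult)
qed

text \<open>By the quadratic equation for $K$ this is the ring $\mathbb{Z}[\xi(q^2)][K]$.\<close>

definition ZYK :: "rat fps set" where
  "ZYK = {int_poly_at p Y_fps + int_poly_at r Y_fps * K_fps |p r. True}"

lemma ZYK_mult:
  assumes "f \<in> ZYK" "g \<in> ZYK"
  shows "f * g \<in> ZYK"
proof -
  obtain p r where f: "f = int_poly_at p Y_fps + int_poly_at r Y_fps * K_fps"
    using assms(1) by (auto simp: ZYK_def)
  obtain p' r' where g: "g = int_poly_at p' Y_fps + int_poly_at r' Y_fps * K_fps"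
    using assms(2) by (auto simp: ZYK_def)
  \<comment> \<open>The terms with \<open>r * r'\<close> come from replacing $K^2$ by $2YK -
    Y$.\<close>
  have "f * g = int_poly_at (p * p' + [:-1:] * ([:0, 1:] * (r * r'))) Y_fps +
          int_poly_at (p * r' + r * p' + [:2:] * ([:0, 1:] * (r * r'))) Y_fps * K_fps"
    using K_square
    unfolding f g int_poly_at_add int_poly_at_mult int_poly_at_X int_poly_at_const of_int_minus of_int_1 of_int_numeral
    by algebra
  thus ?thesis unfolding ZYK_def by blast
qed

lemma ZYK_int_poly_at: "int_poly_at p Y_fps \<in> ZYK"
  unfolding ZYK_def by (rule CollectI, rule exI[of _ p], rule exI[of _ 0]) simp

lemma ZYK_power: "f \<in> ZYK \<Longrightarrow> f ^ n \<in> ZYK"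
  using ZYK_int_poly_at[of "[:1:]"]
  by (induction n) (auto simp: int_poly_at_const intro: ZYK_mult)

lemma ZYK_add:
  assumes "f \<in> ZYK" "g \<in> ZYK"
  shows "f + g \<in> ZYK"
proof -
  obtain p r where f: "f = int_poly_at p Y_fps + int_poly_at r Y_fps * K_fps"
    using assms(1) by (auto simp: ZYK_def)
  obtain p' r' where g: "g = int_poly_at p' Y_fps + int_poly_at r' Y_fps * K_fps"
    using assms(2) by (auto simp: ZYK_def)
  have "f + g = int_poly_at (p + p') Y_fps + int_poly_at (r + r') Y_fps * K_fps"
    unfolding f g int_poly_at_add by (simp add: algebra_simps)
  thus ?thesis unfolding ZYK_def by blast
qed

lemma ZYK_K: "K_fps \<in> ZYK"
  unfolding ZYK_def
  by (rule CollectI, rule exI[of _ 0], rule exI[of _ "[:1:]"]) (simp add: int_poly_at_const)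

lemma ZYK_xi: "xi_fps \<in> ZYK"
proof -
  have "2 * Y_fps - K_fps \<in> ZYK"
    unfolding ZYK_def
    by (rule CollectI, rule exI[of _ "[:0, 2:]"], rule exI[of _ "[:-1:]"])
       (simp add: int_poly_at_pCons)
  moreover have "3 - 4 * Y_fps + 2 * K_fps \<in> ZYK"
    unfolding ZYK_def
    by (rule CollectI, rule exI[of _ "[:3, -4:]"], rule exI[of _ "[:2:]"])
       (simp add: int_poly_at_pCons)
  ultimately show ?thesis
    unfolding xi_eq by (rule ZYK_mult)
qed

lemma ZYK_int_poly_at_xi: "int_poly_at p xi_fps \<in> ZYK"
proof (induction p)
  case 0
  show ?case using ZYK_int_poly_at[of 0] by simp
next
  case (pCons a p)
  have "of_int a \<in> ZYK"
    using ZYK_int_poly_at[of "[:a:]"] by (simp add: int_poly_at_const)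
  with pCons show ?case
    by (auto simp: int_poly_at_pCons intro: ZYK_add ZYK_mult ZYK_xi)
qed

lemma fps_U_ZYK:
  assumes "f \<in> ZYK"
  shows "\<exists>p. fps_U f = int_poly_at p xi_fps"
proof -
  obtain p r where f: "f = int_poly_at p Y_fps + int_poly_at r Y_fps * K_fps"
    using assms by (auto simp: ZYK_def)
  have "fps_U f = int_poly_at p xi_fps + int_poly_at r xi_fps * xi_fps"
    unfolding f Y_fps_def int_poly_at_dilate by (simp only: fps_U_add fps_U_dilate fps_U_dilate_mult fps_U_K)
  also have "\<dots> = int_poly_at (p + r * [:0, 1:]) xi_fps"
    by (simp only: int_poly_at_add int_poly_at_mult int_poly_at_X)
  finally show ?thesis by blast
qed

lemma Lambda_2_poly: "Lambda 2 = int_poly_at [:0, 0, 3, -2:] xi_fps"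
  unfolding Lambda_2 by (simp add: int_poly_at_pCons) algebra

lemma Lambda_int_poly:
  assumes "k \<ge> 2"
  shows "\<exists>p. Lambda k = int_poly_at p xi_fps"
  using assms
proof (induction k rule: dec_induct)
  case base
  show ?case using Lambda_2_poly by blast
next
  case (step k)
  then obtain p where p: "Lambda k = int_poly_at p xi_fps" by blast
  have "Lambda (Suc k) = fps_U (kappa_fps ^ (2 ^ (Suc k - 3)) * int_poly_at p xi_fps)"
    using Lambda_step[of "Suc k"] step.hyps p by simp
  thus ?case
    using fps_U_ZYK[OF ZYK_mult[OF ZYK_power ZYK_int_poly_at_xi]] ZYK_power[OF ZYK_K, of 5]
    by (simp only: kappa_eq)
qed

theorem theorem2p7:
  shows "\<exists>c :: nat \<Rightarrow> int poly.
     (\<forall>k\<ge>2. Lambda k = int_poly_at (c k) xi_fps) \<and>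
     c 2 = [:0, 0, 3, -2:] \<and>
     (\<forall>k\<ge>3. Lambda k =
        (\<Sum>l\<le>degree (c (k - 1)). fps_const (of_int (coeff (c (k - 1)) l)) * zeta (2 ^ (k - 3)) l))"
proof -
  \<comment> \<open>Any polynomial representing \<open>Lambda (k - 1)\<close> serves, since the
    expansion uses only its value at \<xi>; the case 2 is fixed explicitly to meet the required
    form.\<close>
  define c where "c = (\<lambda>k. if k = 2 then [:0, 0, 3, -2:] else SOME p. Lambda k = int_poly_at p xi_fps)"
  have c: "Lambda k = int_poly_at (c k) xi_fps" if "k \<ge> 2" for k
    using Lambda_2_poly someI_ex[OF Lambda_int_poly[OF that]] by (simp add: c_def)
  have "Lambda k = (\<Sum>l\<le>degree (c (k - 1)). fps_const (of_int (coeff (c (k - 1)) l)) * zeta (2 ^ (k - 3)) l)"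
    if k: "k \<ge> 3" for k
  proof -
    have "Lambda k = fps_U (kappa_fps ^ (2 ^ (k - 3)) * int_poly_at (c (k - 1)) xi_fps)"
      using Lambda_step[OF k] c[of "k - 1"] k by simp
    also have "\<dots> = fps_U (\<Sum>l\<le>degree (c (k - 1)). fps_const (of_int (coeff (c (k - 1)) l)) *
                        (kappa_fps ^ (2 ^ (k - 3)) * xi_fps ^ l))"
      by (simp only: int_poly_at_altdef sum_distrib_left mult.left_commute)
    finally show ?thesis
      by (simp only: fps_U_sum fps_U_const_mult zeta_def)
  qed
  with c show ?thesis
    by (intro exI[of _ c]) (simp add: c_def)
qed

end
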